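(* Let $M\in\mathbb{N}$ (so $M\ge 1$). Then there exists a function $f\in\mathcal{S}_3$ of infinite order, i.e. $\rho(f)=\infty$, such that all poles of $f$ have multiplicity $M$ and $\dim I(f)=2$.
   Context: A transcendental meromorphic function is a non-rational meromorphic function $f\colon\mathbb{C}\to\widehat{\mathbb{C}}:=\mathbb{C}\cup\{\infty\}$. For such $f$, $\operatorname{sing}(f^{-1})\subset\widehat{\mathbb{C}}$ denotes the set of critical and asymptotic values of $f$. Here a critical value is the image $f(c)\in\widehat{\mathbb C}$ of a point $c\in\mathbb{C}$ at which $f$, as a holomorphic map into $\widehat{\mathbb C}$, is not locally injective (so $\infty$ is a critical value if $f$ has a multiple pole), and an asymptotic value is a point $w\in\widehat{\mathbb{C}}$ for which there is a curve $\gamma\colon[0,\infty)\to\mathbb{C}$ with $\gamma(s)\to\infty$ and $f(\gamma(s))\to w$ as $s\to\infty$. For $q\in\mathbb{N}$, $\mathcal{S}_q$ is the set of transcendental meromorphic functions $f$ such that $\operatorname{sing}(f^{-1})$ is finite of cardinality exactly $q$. The order of $f$ is $\rho(f)=\limsup_{r\to\infty}\frac{\log T(r,f)}{\log r}$, where $T(r,f)$ is the Nevanlinna characteristic. The escaping set $I(f)$ is the set of all $z\in\mathbb{C}$ for which all iterates $f^n(z)$, $n\in\mathbb{N}$, are defined (as points of $\mathbb{C}$) and $f^n(z)\to\infty$ as $n\to\infty$. $\dim A$ denotes the Hausdorff dimension of a set $A\subset\mathbb{C}$. *)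

theory Defs
  imports "HOL-Complex_Analysis.Complex_Analysis"
begin

section \<open>Meromorphic functions as maps into the Riemann sphere\<close>

text \<open>
  A meromorphic function on the plane is represented by \<open>f :: complex \<Rightarrow> complex\<close> with
  \<open>f nicely_meromorphic_on UNIV\<close>: removable singularities are filled in, and \<open>f\<close> carries the
  dummy value 0 at its poles.  The point \<open>None\<close> of the sphere plays the role of infinity.
\<close>

definition riemann_sphere :: "complex option topology" where
  "riemann_sphere = Alexandroff_compactification euclidean"

definition sphere_map :: "(complex \<Rightarrow> complex) \<Rightarrow> complex \<Rightarrow> complex option" where
  "sphere_map f z = (if is_pole f z then None else Some (f z))"

definition rational_function :: "(complex \<Rightarrow> complex) \<Rightarrow> bool" where
  "rational_function f \<longleftrightarrow>
     (\<exists>p q :: complex poly. q \<noteq> 0 \<and> (\<forall>z. poly q z \<noteq> 0 \<longrightarrow> f z = poly p z / poly q z))"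

definition transcendental_meromorphic :: "(complex \<Rightarrow> complex) \<Rightarrow> bool" where
  "transcendental_meromorphic f \<longleftrightarrow> f nicely_meromorphic_on UNIV \<and> \<not> rational_function f"


section \<open>Singular values and the classes \<open>S\<^sub>q\<close>\<close>

definition critical_point :: "(complex \<Rightarrow> complex) \<Rightarrow> complex \<Rightarrow> bool" where
  "critical_point f c \<longleftrightarrow> \<not> (\<exists>U. open U \<and> c \<in> U \<and> inj_on (sphere_map f) U)"

definition critical_values :: "(complex \<Rightarrow> complex) \<Rightarrow> complex option set" where
  "critical_values f = sphere_map f ` {c. critical_point f c}"

definition asymptotic_values :: "(complex \<Rightarrow> complex) \<Rightarrow> complex option set" where
  "asymptotic_values f =
     {w. \<exists>\<gamma> :: real \<Rightarrow> complex. continuous_on {0..} \<gamma> \<and> filterlim \<gamma> at_infinity at_top \<and>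
           limitin riemann_sphere (\<lambda>s. sphere_map f (\<gamma> s)) w at_top}"

definition sing_inv :: "(complex \<Rightarrow> complex) \<Rightarrow> complex option set" where
  "sing_inv f = critical_values f \<union> asymptotic_values f"

definition speiser_class :: "nat \<Rightarrow> (complex \<Rightarrow> complex) set" where
  "speiser_class q =
     {f. transcendental_meromorphic f \<and> finite (sing_inv f) \<and> card (sing_inv f) = q}"


section \<open>Nevanlinna characteristic and order\<close>

definition pole_multiplicity :: "(complex \<Rightarrow> complex) \<Rightarrow> complex \<Rightarrow> nat" where
  "pole_multiplicity f z = nat (- zorder f z)"

definition pole_count :: "(complex \<Rightarrow> complex) \<Rightarrow> real \<Rightarrow> nat" where
  "pole_count f r = (\<Sum>z\<in>{z. is_pole f z \<and> cmod z \<le> r}. pole_multiplicity f z)"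

definition nevanlinna_N :: "(complex \<Rightarrow> complex) \<Rightarrow> real \<Rightarrow> real" where
  "nevanlinna_N f r =
     integral {0..r} (\<lambda>t. (real (pole_count f t) - real (pole_count f 0)) / t)
       + real (pole_count f 0) * ln r"

definition nevanlinna_m :: "(complex \<Rightarrow> complex) \<Rightarrow> real \<Rightarrow> real" where
  "nevanlinna_m f r =
     1 / (2 * pi) * integral {0..2 * pi} (\<lambda>\<theta>. ln (max 1 (cmod (f (of_real r * cis \<theta>)))))"

definition nevanlinna_T :: "(complex \<Rightarrow> complex) \<Rightarrow> real \<Rightarrow> real" where
  "nevanlinna_T f r = nevanlinna_m f r + nevanlinna_N f r"

definition meromorphic_order :: "(complex \<Rightarrow> complex) \<Rightarrow> ereal" where
  "meromorphic_order f = Limsup at_top (\<lambda>r. ereal (ln (nevanlinna_T f r) / ln r))"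


section \<open>Escaping set\<close>

text \<open>
  All iterates of \<open>z\<close> are defined as points of the plane iff the orbit computed with the
  total function \<open>f\<close> never hits a pole, so the dummy values at poles are never used.
\<close>

definition escaping_set :: "(complex \<Rightarrow> complex) \<Rightarrow> complex set" where
  "escaping_set f =
     {z. (\<forall>n. \<not> is_pole f ((f ^^ n) z)) \<and>
         filterlim (\<lambda>n. (f ^^ n) z) at_infinity sequentially}"


section \<open>Hausdorff dimension\<close>

text \<open>
  The covering sets are required to be bounded because \<^const>\<open>diameter\<close> is not meaningful
  otherwise.  Only exponents \<open>s > 0\<close> are used below (\<open>0 powr 0 = 0\<close> would give the wrong
  measure for \<open>s = 0\<close>); this does not affect the infimum defining the dimension.
\<close>

definition hausdorff_premeasure :: "real \<Rightarrow> real \<Rightarrow> 'a::metric_space set \<Rightarrow> ennreal" where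
  "hausdorff_premeasure s \<delta> A =
     (INF U \<in> {U :: nat \<Rightarrow> 'a set. A \<subseteq> (\<Union>i. U i) \<and> (\<forall>i. bounded (U i) \<and> diameter (U i) \<le> \<delta>)}.
        (\<Sum>i. ennreal (diameter (U i) powr s)))"

definition hausdorff_measure :: "real \<Rightarrow> 'a::metric_space set \<Rightarrow> ennreal" where
  "hausdorff_measure s A = (SUP \<delta> \<in> {0<..}. hausdorff_premeasure s \<delta> A)"

definition hausdorff_dim :: "'a::metric_space set \<Rightarrow> ereal" where
  "hausdorff_dim A = (INF s \<in> {s. 0 < s \<and> hausdorff_measure s A = 0}. ereal s)"

end

theory Submission
  imports Defs "HOL-Real_Asymp.Real_Asymp"
begin

text \<open>
  The example is \<open>f(z) = h(exp(exp z))\<close> with the rational function \<open>h(w) = w^(M+1) / (w-1)^M\<close>.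

  Singular values.  The function \<open>exp \<circ> exp\<close> has no critical points and the asymptotic values 0, 1 and
  infinity.  The critical points of \<open>h\<close> are among 0, 1, infinity and \<open>M + 1\<close>, and \<open>h\<close> fixes 0 and infinity
  and maps 1 to infinity.  So the singular values of \<open>f\<close> are exactly 0, infinity and \<open>h(M + 1)\<close>
  (\<open>sing_inv_belyi_exp_exp\<close>).  The value 1 of \<open>exp \<circ> exp\<close> is taken infinitely often and always simply, so
  \<open>f\<close> has infinitely many poles, all of multiplicity \<open>M\<close>.

  Order.  In the strip \<open>\<bar>Im z\<bar> \<le> 1\<close> the modulus of \<open>f\<close> is at least \<open>2^(-M) exp(exp(Re z) / 2)\<close>.  An arc of length
  about 1 of the circle of radius \<open>r\<close> lies there, and this alone makes the proximity function, hence
  the characteristic, grow exponentially in \<open>r\<close>.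

  Dimension.  A planar set has dimension at most 2, so only the lower bound matters.  Near the
  horizontal lines \<open>Im z \<in> 2 \<pi> \<int>\<close> and far to the right, a disc of radius \<open>20 exp(-Re z)\<close> is mapped by
  \<open>exp\<close> onto a region that contains a disc of radius 10, by \<open>exp \<circ> exp\<close> onto a region that contains a round
  annulus of size \<open>r = \<bar>exp(exp z)\<bar>\<close>, and by \<open>f\<close> onto a region that contains a slightly smaller annulus,
  because \<open>h(w) = w + O(1)\<close> at infinity (\<open>belyi_exp_exp_covers_annulus\<close>).  This annulus contains about
  \<open>r^2\<close> unit squares of the same kind far to the right, and on the disc \<open>f\<close> is Lipschitz with a
  constant of order \<open>r exp(Re z)\<close>.  Hence in a unit square the points that are sent to squares of the
  same kind fill a definite proportion, at two well separated scales.  This is the situation of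
  McMullen's estimate for the exponential function.

  In place of a mass distribution on the limit set, the proof bounds from below the sums of
  \<open>diameter^s\<close> over \<^emph>\<open>finite\<close> covers of the sets of points whose first \<open>n\<close> iterates behave as described.  If
  many small pieces, evenly distributed in a square, all satisfy such a bound with constant \<open>c\<close>, then so
  does their union, with a constant that does not depend on \<open>c\<close> as soon as the number of pieces is
  large (\<open>content_ge_grid\<close>; this is where \<open>s < 2\<close> enters).  So one constant serves for all \<open>n\<close>, and
  compactness transfers it to the points that follow the pattern for ever, all of which escape.
\<close>

section \<open>Lower bounds for covers by finitely many sets\<close>

text \<open>
  Only finite covers are considered, which keeps all sums finite; for decreasing sequences of
  compact sets nothing is lost (\<open>hausdorff_measure_pos_of_content_ge\<close>).
\<close>
definition content_ge :: "real \<Rightarrow> 'a::metric_space set \<Rightarrow> real \<Rightarrow> bool" where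
  "content_ge s A c \<longleftrightarrow>
     (\<forall>\<U>. finite \<U> \<longrightarrow> (\<forall>U\<in>\<U>. bounded U) \<longrightarrow> A \<subseteq> \<Union>\<U> \<longrightarrow> c \<le> (\<Sum>U\<in>\<U>. diameter U powr s))"

lemma content_geD:
  assumes "content_ge s A c" "finite \<U>" "\<And>U. U \<in> \<U> \<Longrightarrow> bounded U" "A \<subseteq> \<Union>\<U>"
  shows "c \<le> (\<Sum>U\<in>\<U>. diameter U powr s)"
  using assms unfolding content_ge_def by blast

lemma content_ge_mono:
  assumes "content_ge s A c" "A \<subseteq> B" "c' \<le> c"
  shows "content_ge s B c'"
  unfolding content_ge_def
proof (intro allI impI)
  fix \<U> assume "finite \<U>" "\<forall>U\<in>\<U>. bounded U" "B \<subseteq> \<Union>\<U>"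
  with assms have "c \<le> (\<Sum>U\<in>\<U>. diameter U powr s)" by (intro content_geD[OF assms(1)]) auto
  with assms show "c' \<le> (\<Sum>U\<in>\<U>. diameter U powr s)" by linarith
qed

text \<open>
  The images of the sets of a cover of \<open>B\<close> cover \<open>A\<close>, and their diameters are larger by a factor of at most
  \<open>L\<close>.  Only \<open>A \<subseteq> f ` B\<close> is required, so the bound can be pulled back along maps that are not injective.
\<close>
lemma content_ge_lipschitz:
  fixes f :: "'a::metric_space \<Rightarrow> 'b::metric_space"
  assumes A: "content_ge s A c" and s: "0 < s" and L: "0 < L"
    and sub: "A \<subseteq> f ` B"
    and lip: "\<And>x y. x \<in> B \<Longrightarrow> y \<in> B \<Longrightarrow> dist (f x) (f y) \<le> L * dist x y"
  shows "content_ge s B (c / L powr s)"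
  unfolding content_ge_def
proof (intro allI impI)
  fix \<U> assume fin: "finite \<U>" and bd: "\<forall>U\<in>\<U>. bounded U" and cov: "B \<subseteq> \<Union>\<U>"
  define \<V> where "\<V> = (\<lambda>U. f ` (U \<inter> B)) ` \<U>"
  have d: "dist u v \<le> L * diameter U" if U: "U \<in> \<U>" and "u \<in> f ` (U \<inter> B)" "v \<in> f ` (U \<inter> B)" for U u v
  proof -
    from that obtain x y where xy: "x \<in> U" "x \<in> B" "y \<in> U" "y \<in> B" "u = f x" "v = f y" by auto
    have "dist u v \<le> L * dist x y" using lip xy by auto
    also have "\<dots> \<le> L * diameter U"
      using diameter_bounded_bound[of U x y] U bd xy L by (intro mult_left_mono) auto
    finally show ?thesis .
  qed
  have bdV: "bounded (f ` (U \<inter> B))" if "U \<in> \<U>" for U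
    using d[OF that] unfolding bounded_two_points by blast
  have dV: "diameter (f ` (U \<inter> B)) \<le> L * diameter U" if "U \<in> \<U>" for U
  proof (cases "f ` (U \<inter> B) = {}")
    case True
    then show ?thesis using L diameter_ge_0[of U] that bd by simp
  next
    case False
    have "diameter (f ` (U \<inter> B)) = (SUP (x, y)\<in>(f ` (U \<inter> B)) \<times> (f ` (U \<inter> B)). dist x y)"
      using False unfolding diameter_def by (simp only: if_False)
    also have "\<dots> \<le> L * diameter U"
    proof (rule cSUP_least)
      fix p assume "p \<in> (f ` (U \<inter> B)) \<times> (f ` (U \<inter> B))"
      then show "(case p of (x, y) \<Rightarrow> dist x y) \<le> L * diameter U" using d[OF that] by (cases p) simp
    qed (use False in auto)
    finally show ?thesis .
  qed
  have "c \<le> (\<Sum>V\<in>\<V>. diameter V powr s)"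
  proof (rule content_geD[OF A])
    show "A \<subseteq> \<Union>\<V>"
    proof
      fix y assume "y \<in> A"
      then obtain x where "x \<in> B" "y = f x" using sub by blast
      moreover from this cov obtain U where "U \<in> \<U>" "x \<in> U" by blast
      ultimately show "y \<in> \<Union>\<V>" unfolding \<V>_def by blast
    qed
  qed (use fin bdV in \<open>auto simp: \<V>_def\<close>)
  also have "\<dots> \<le> (\<Sum>U\<in>\<U>. diameter (f ` (U \<inter> B)) powr s)"
    unfolding \<V>_def by (rule sum_image_le[OF fin, simplified o_def]) auto
  also have "\<dots> \<le> (\<Sum>U\<in>\<U>. (L * diameter U) powr s)"
    using dV s by (intro sum_mono powr_mono2) (auto simp: diameter_ge_0 bdV)
  also have "\<dots> = L powr s * (\<Sum>U\<in>\<U>. diameter U powr s)"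
    using L bd by (simp add: sum_distrib_left powr_mult diameter_ge_0)
  finally show "c / L powr s \<le> (\<Sum>U\<in>\<U>. diameter U powr s)"
    using L by (simp add: field_simps)
qed

text \<open>
  A bounded set lies in a square of side twice its diameter, so a cover by sets of diameter at most 1
  satisfies \<open>1 \<le> \<Sum> 4 diameter^2 \<le> 4 \<Sum> diameter^s\<close> by comparison of areas.  The constant \<open>1/512\<close> is far from optimal;
  it is the one that the inductive step reproduces.
\<close>
lemma content_ge_unit_square:
  assumes "0 < s" "s < 2"
  shows "content_ge s (cbox a (a + Complex 1 1)) (1/512)"
  unfolding content_ge_def
proof (intro allI impI)
  fix \<U> :: "complex set set"
  assume fin: "finite \<U>" and bd: "\<forall>U\<in>\<U>. bounded U" and cov: "cbox a (a + Complex 1 1) \<subseteq> \<Union>\<U>"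
  have nn: "0 \<le> diameter U powr s" for U :: "complex set" by simp
  show "1/512 \<le> (\<Sum>U\<in>\<U>. diameter U powr s)"
  proof (cases "\<exists>U\<in>\<U>. diameter U > 1")
    case True
    then obtain U where U: "U \<in> \<U>" "diameter U > 1" by auto
    have "1 \<le> diameter U powr s" using U assms by (intro ge_one_powr_ge_zero) auto
    also have "\<dots> \<le> (\<Sum>U\<in>\<U>. diameter U powr s)"
      using U fin by (intro member_le_sum) auto
    finally show ?thesis by simp
  next
    case False
    define c where "c = (\<lambda>U::complex set. SOME u. u \<in> U)"
    define Q where "Q = (\<lambda>U. cbox (c U - diameter U *\<^sub>R Complex 1 1) (c U + diameter U *\<^sub>R Complex 1 1))"
    have QU: "U \<subseteq> Q U" if "U \<in> \<U>" for U
    proof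
      fix x assume x: "x \<in> U"
      then have "c U \<in> U" unfolding c_def by (rule someI)
      then have "cmod (x - c U) \<le> diameter U"
        using x bd that diameter_bounded_bound[of U x "c U"] by (auto simp: dist_norm)
      then have "\<bar>Re (x - c U)\<bar> \<le> diameter U" "\<bar>Im (x - c U)\<bar> \<le> diameter U"
        using abs_Re_le_cmod[of "x - c U"] abs_Im_le_cmod[of "x - c U"] by linarith+
      then show "x \<in> Q U" by (auto simp: Q_def in_cbox_complex_iff)
    qed
    have mQ: "measure lborel (Q U) = 4 * (diameter U)\<^sup>2" if "U \<in> \<U>" for U
      using that bd diameter_ge_0[of U]
      by (auto simp: Q_def content_cbox_if box_eq_empty Basis_complex_def inner_complex_def power2_eq_square)
    have "1 = measure lborel (cbox a (a + Complex 1 1))"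
      by (auto simp: content_cbox_if box_eq_empty Basis_complex_def inner_complex_def)
    also have "\<dots> \<le> measure lborel (\<Union>U\<in>\<U>. Q U)"
    proof (rule measure_mono_fmeasurable)
      show "cbox a (a + Complex 1 1) \<subseteq> (\<Union>U\<in>\<U>. Q U)" using cov QU by blast
      show "(\<Union>U\<in>\<U>. Q U) \<in> fmeasurable lborel"
        using fin unfolding Q_def by (intro fmeasurable.finite_UN) auto
    qed auto
    also have "\<dots> \<le> (\<Sum>U\<in>\<U>. measure lborel (Q U))"
      using fin by (intro measure_UNION_le) (auto simp: Q_def)
    also have "\<dots> = (\<Sum>U\<in>\<U>. 4 * (diameter U)\<^sup>2)" using mQ by simp
    also have "\<dots> \<le> (\<Sum>U\<in>\<U>. 4 * diameter U powr s)"
    proof (intro sum_mono mult_left_mono)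
      fix U assume U: "U \<in> \<U>"
      have "0 \<le> diameter U" "diameter U \<le> 1" using U False bd by (auto simp: diameter_ge_0)
      then show "(diameter U)\<^sup>2 \<le> diameter U powr s"
        using assms powr_mono'[of s 2 "diameter U"] by (cases "diameter U = 0") (auto simp: )
    qed auto
    also have "\<dots> = 4 * (\<Sum>U\<in>\<U>. diameter U powr s)" by (simp add: sum_distrib_left)
    finally show ?thesis by simp
  qed
qed

lemma card_le_of_spread:
  fixes A :: "nat set"
  assumes "finite A" "1 \<le> x" "\<And>i k. i \<in> A \<Longrightarrow> k \<in> A \<Longrightarrow> \<bar>real i - real k\<bar> \<le> x"
  shows "real (card A) \<le> 2 * x"
proof (cases "A = {}")
  case False
  define m where "m = Min A"
  have m: "m \<in> A" "\<And>i. i \<in> A \<Longrightarrow> m \<le> i" using False assms by (auto simp: m_def)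
  have "A \<subseteq> {m..m + nat \<lfloor>x\<rfloor>}"
  proof
    fix i assume i: "i \<in> A"
    have "real i - real m \<le> x" using assms(3)[OF i m(1)] by linarith
    then have "int i - int m \<le> \<lfloor>x\<rfloor>" by (simp add: le_floor_iff)
    then show "i \<in> {m..m + nat \<lfloor>x\<rfloor>}" using m(2)[OF i] by auto
  qed
  then have "card A \<le> nat \<lfloor>x\<rfloor> + 1" using card_mono[of "{m..m + nat \<lfloor>x\<rfloor>}" A] by simp
  then have "real (card A) \<le> x + 1" using assms(2) of_int_floor_le[of x] by linarith
  then show ?thesis using assms(2) by linarith
qed (use assms in auto)

text \<open>
  The key estimate.  Call a set of a cover big if its diameter is at least \<open>\<sigma> / 2\<close>.  A big set \<open>U\<close> meets at most
  \<open>16 (diameter U / \<sigma>)^2\<close> of the \<open>N^2\<close> pieces, a small one at most one piece.  If the big sets meet half of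
  the pieces, then \<open>diameter^2 \<le> (N \<sigma>)^(2-s) diameter^s\<close> gives the bound.  Otherwise half of the
  pieces are covered by small sets alone, each piece by its own ones, and the sum is at least
  \<open>N^2 / 2\<close> times \<open>c \<sigma>^s\<close>.  The last assumption says that this second bound is at least as good as the first; the
  constant \<open>c\<close> of the pieces then disappears from the conclusion.
\<close>
lemma content_ge_grid:
  fixes p :: complex and E :: "nat \<times> nat \<Rightarrow> complex set" and N :: nat
  assumes s: "0 < s" "s < 2" and \<sigma>: "0 < \<sigma>" and N: "1 \<le> N"
    and sub: "\<And>i j. i < N \<Longrightarrow> j < N \<Longrightarrow> E (i, j) \<subseteq> cball (p + of_real \<sigma> * Complex (real i) (real j)) (\<sigma> / 4)"
    and E: "\<And>i j. i < N \<Longrightarrow> j < N \<Longrightarrow> content_ge s (E (i, j)) (c * \<sigma> powr s)"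
    and c: "1 / 16 \<le> c * real N powr (2 - s)"
  shows "content_ge s (\<Union>i<N. \<Union>j<N. E (i, j)) ((real N * \<sigma>) powr s / 32)"
  unfolding content_ge_def
proof (intro allI impI)
  fix \<U> :: "complex set set"
  assume fin: "finite \<U>" and bd: "\<forall>U\<in>\<U>. bounded U" and cov: "(\<Union>i<N. \<Union>j<N. E (i, j)) \<subseteq> \<Union>\<U>"
  define J where "J = {..<N} \<times> {..<N}"
  define T where "T = (\<lambda>U. {e\<in>J. E e \<inter> U \<noteq> {}})"
  define D where "D = real N * \<sigma>"
  define big where "big = {U\<in>\<U>. diameter U \<ge> \<sigma> / 2}"
  define small where "small = {U\<in>\<U>. diameter U < \<sigma> / 2}"
  define \<Sigma> where "\<Sigma> = (\<Sum>U\<in>\<U>. diameter U powr s)"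
  have finJ: "finite J" "card J = N\<^sup>2" by (auto simp: J_def power2_eq_square)
  have finT: "finite (T U)" for U using finJ by (auto simp: T_def)
  have D: "D > 0" using N \<sigma> by (simp add: D_def)
  have spread: "\<bar>real (fst e) - real (fst e')\<bar> * \<sigma> \<le> diameter U + \<sigma> / 2 \<and>
                \<bar>real (snd e) - real (snd e')\<bar> * \<sigma> \<le> diameter U + \<sigma> / 2"
    if U: "U \<in> \<U>" and e: "e \<in> T U" "e' \<in> T U" for U e e'
  proof -
    define q where "q = (\<lambda>e::nat\<times>nat. p + of_real \<sigma> * Complex (real (fst e)) (real (snd e)))"
    obtain x y where x: "x \<in> E e" "x \<in> U" and y: "y \<in> E e'" "y \<in> U" using e by (auto simp: T_def)
    have "dist (q e) x \<le> \<sigma> / 4" "dist (q e') y \<le> \<sigma> / 4"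
      using sub[of "fst e" "snd e"] sub[of "fst e'" "snd e'"] e x y
      by (auto simp: T_def J_def q_def dist_commute subset_iff)
    moreover have "dist x y \<le> diameter U" using diameter_bounded_bound[of U x y] bd U x y by auto
    moreover have "dist (q e) (q e') \<le> dist (q e) x + dist x y + dist (q e') y"
      by metric
    ultimately have "cmod (q e - q e') \<le> diameter U + \<sigma> / 2" by (simp add: dist_norm)
    then have "\<bar>Re (q e - q e')\<bar> \<le> diameter U + \<sigma> / 2" "\<bar>Im (q e - q e')\<bar> \<le> diameter U + \<sigma> / 2"
      using abs_Re_le_cmod[of "q e - q e'"] abs_Im_le_cmod[of "q e - q e'"] by linarith+
    then show ?thesis using \<sigma>
      by (auto simp: q_def right_diff_distrib[symmetric] abs_mult mult.commute)
  qed
  have Tbig: "real (card (T U)) \<le> 16 * (diameter U)\<^sup>2 / \<sigma>\<^sup>2" if "U \<in> big" for U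
  proof -
    have U: "U \<in> \<U>" and dU: "\<sigma> / 2 \<le> diameter U" using that by (auto simp: big_def)
    define x where "x = 2 * diameter U / \<sigma>"
    have x1: "1 \<le> x" using dU \<sigma> by (simp add: x_def field_simps)
    have "\<bar>real (fst e) - real (fst e')\<bar> \<le> x" "\<bar>real (snd e) - real (snd e')\<bar> \<le> x"
      if "e \<in> T U" "e' \<in> T U" for e e'
      using spread[OF U that] dU \<sigma> by (auto simp: x_def pos_le_divide_eq)
    then have "real (card (fst ` T U)) \<le> 2 * x" "real (card (snd ` T U)) \<le> 2 * x"
      using finT x1 by (intro card_le_of_spread; auto)+
    moreover have "card (T U) \<le> card (fst ` T U \<times> snd ` T U)"
      using finT by (intro card_mono subset_fst_snd) auto
    ultimately have "real (card (T U)) \<le> 2 * x * (2 * x)"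
      using x1 mult_mono[of "real (card (fst ` T U))" "2 * x" "real (card (snd ` T U))" "2 * x"]
      by (simp add: card_cartesian_product) (smt (verit) of_nat_le_iff of_nat_mult)
    also have "\<dots> = 16 * (diameter U)\<^sup>2 / \<sigma>\<^sup>2"
      by (simp add: x_def power2_eq_square field_simps)
    finally show ?thesis .
  qed
  have Tsmall: "card (T U) \<le> 1" if "U \<in> small" for U
  proof -
    have U: "U \<in> \<U>" and dU: "diameter U < \<sigma> / 2" using that by (auto simp: small_def)
    have "e = e'" if "e \<in> T U" "e' \<in> T U" for e e'
    proof -
      have "\<bar>real (fst e) - real (fst e')\<bar> * \<sigma> < 1 * \<sigma>" "\<bar>real (snd e) - real (snd e')\<bar> * \<sigma> < 1 * \<sigma>"
        using spread[OF U that] dU by linarith+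
      then have "\<bar>real (fst e) - real (fst e')\<bar> < 1" "\<bar>real (snd e) - real (snd e')\<bar> < 1"
        using \<sigma> by (simp_all only: mult_less_cancel_right_pos[OF \<sigma>])
      then show ?thesis by (auto simp: prod_eq_iff)
    qed
    then show ?thesis using finT[of U] by (auto simp: card_le_Suc0_iff_eq)
  qed
  have fin': "finite big" "finite small" using fin by (auto simp: big_def small_def)
  have "D powr s / 32 \<le> \<Sigma>"
  proof (cases "\<exists>U\<in>\<U>. diameter U > D")
    case True
    then obtain U where U: "U \<in> \<U>" "diameter U > D" by auto
    have "D powr s / 32 \<le> D powr s" by simp
    also have "\<dots> \<le> diameter U powr s" using U D s by (intro powr_mono2) auto
    also have "\<dots> \<le> \<Sigma>" unfolding \<Sigma>_def using U fin by (intro member_le_sum) auto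
    finally show ?thesis .
  next
    case False
    define JB where "JB = (\<Union>U\<in>big. T U)"
    have JB: "finite JB" "JB \<subseteq> J" using fin' finT by (auto simp: JB_def T_def)
    show ?thesis
    proof (cases "real (card JB) \<ge> real (N\<^sup>2) / 2")
      case True
      have "real (N\<^sup>2) / 2 \<le> real (card JB)" by (rule True)
      also have "\<dots> \<le> (\<Sum>U\<in>big. real (card (T U)))"
        unfolding JB_def using card_UN_le[OF fin'(1), of T] by (metis of_nat_le_iff of_nat_sum)
      also have "\<dots> \<le> (\<Sum>U\<in>big. 16 / \<sigma>\<^sup>2 * D powr (2 - s) * diameter U powr s)"
      proof (rule sum_mono)
        fix U assume U: "U \<in> big"
        have d: "0 < diameter U" "diameter U \<le> D" using U False \<sigma> by (auto simp: big_def)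
        have "(diameter U)\<^sup>2 = diameter U powr (2 - s) * diameter U powr s"
          using d by (simp add: powr_add[symmetric])
        also have "\<dots> \<le> D powr (2 - s) * diameter U powr s"
          using d s by (intro mult_right_mono powr_mono2) auto
        finally have "16 / \<sigma>\<^sup>2 * (diameter U)\<^sup>2 \<le> 16 / \<sigma>\<^sup>2 * (D powr (2 - s) * diameter U powr s)"
          by (intro mult_left_mono) auto
        then show "real (card (T U)) \<le> 16 / \<sigma>\<^sup>2 * D powr (2 - s) * diameter U powr s"
          using Tbig[OF U] by simp
      qed
      also have "\<dots> = 16 / \<sigma>\<^sup>2 * D powr (2 - s) * (\<Sum>U\<in>big. diameter U powr s)"
        by (simp add: sum_distrib_left)
      also have "\<dots> \<le> 16 / \<sigma>\<^sup>2 * D powr (2 - s) * \<Sigma>"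
        unfolding \<Sigma>_def using fin by (intro mult_left_mono sum_mono2) (auto simp: big_def)
      finally have "real (N\<^sup>2) * \<sigma>\<^sup>2 \<le> 32 * D powr (2 - s) * \<Sigma>"
        using \<sigma> by (simp add: field_simps)
      also have "real (N\<^sup>2) * \<sigma>\<^sup>2 = D powr (2 - s) * D powr s"
        using D by (simp add: powr_add[symmetric]) (simp add: D_def power_mult_distrib)
      finally have "D powr (2 - s) * D powr s \<le> D powr (2 - s) * (32 * \<Sigma>)" by (simp add: mult_ac)
      then show ?thesis using D by simp
    next
      case False
      have cJ: "real (card (J - JB)) \<ge> real (N\<^sup>2) / 2"
        using False JB finJ card_mono[OF finJ(1) JB(2)] by (simp add: card_Diff_subset of_nat_diff)
      have "real (N\<^sup>2) / 2 * (c * \<sigma> powr s) \<le> real (card (J - JB)) * (c * \<sigma> powr s)"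
      proof (intro mult_right_mono cJ)
        have "0 < real N powr (2 - s)" using N by simp
        then show "0 \<le> c * \<sigma> powr s" using c
          by (smt (verit) divide_pos_pos mult_nonneg_nonneg mult_nonpos_nonneg powr_ge_zero)
      qed
      also have "\<dots> = (\<Sum>e\<in>J - JB. c * \<sigma> powr s)" by simp
      also have "\<dots> \<le> (\<Sum>e\<in>J - JB. \<Sum>U\<in>{U\<in>small. e \<in> T U}. diameter U powr s)"
      proof (rule sum_mono)
        fix e assume e: "e \<in> J - JB"
        obtain i j where ij: "e = (i, j)" "i < N" "j < N" using e by (auto simp: J_def)
        show "c * \<sigma> powr s \<le> (\<Sum>U\<in>{U\<in>small. e \<in> T U}. diameter U powr s)"
        proof (rule content_geD)
          show "content_ge s (E e) (c * \<sigma> powr s)" using E ij by auto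
          show "E e \<subseteq> \<Union>{U\<in>small. e \<in> T U}"
          proof
            fix x assume x: "x \<in> E e"
            then obtain U where U: "U \<in> \<U>" "x \<in> U" using cov ij by blast
            then have eT: "e \<in> T U" using x e by (auto simp: T_def)
            then have "U \<notin> big" using e by (auto simp: JB_def)
            then show "x \<in> \<Union>{U\<in>small. e \<in> T U}" using U eT by (auto simp: big_def small_def)
          qed
        qed (use fin bd in \<open>auto simp: small_def\<close>)
      qed
      also have "\<dots> = (\<Sum>U\<in>small. \<Sum>e\<in>{e\<in>J - JB. e \<in> T U}. diameter U powr s)"
        using finJ fin' by (intro sum.swap_restrict) auto
      also have "\<dots> \<le> (\<Sum>U\<in>small. diameter U powr s)"
      proof (rule sum_mono)
        fix U assume U: "U \<in> small"
        have "card {e\<in>J - JB. e \<in> T U} \<le> card (T U)" using finT by (intro card_mono) auto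
        then have "real (card {e\<in>J - JB. e \<in> T U}) \<le> 1" using Tsmall[OF U] by linarith
        then show "(\<Sum>e\<in>{e\<in>J - JB. e \<in> T U}. diameter U powr s) \<le> diameter U powr s"
          by (simp add: mult_left_le_one_le)
      qed
      also have "\<dots> \<le> \<Sigma>" unfolding \<Sigma>_def using fin by (intro sum_mono2) (auto simp: small_def)
      finally have 1: "real (N\<^sup>2) / 2 * (c * \<sigma> powr s) \<le> \<Sigma>" .
      have "D powr s / 32 = (real N powr s * \<sigma> powr s / 2) * (1 / 16)"
        using N \<sigma> by (simp add: D_def powr_mult)
      also have "\<dots> \<le> (real N powr s * \<sigma> powr s / 2) * (c * real N powr (2 - s))"
        using c by (intro mult_left_mono) auto
      also have "\<dots> = (real N powr s * real N powr (2 - s)) / 2 * (c * \<sigma> powr s)" by simp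
      also have "real N powr s * real N powr (2 - s) = real (N\<^sup>2)"
        using N by (simp add: powr_add[symmetric])
      finally show ?thesis using 1 by linarith
    qed
  qed
  then show "(real N * \<sigma>) powr s / 32 \<le> (\<Sum>U\<in>\<U>. diameter U powr s)"
    by (simp add: D_def \<Sigma>_def)
qed

section \<open>Hausdorff measure and dimension in the plane\<close>

lemma hausdorff_premeasure_le:
  assumes "A \<subseteq> (\<Union>i. U i)" "\<And>i. bounded (U i)" "\<And>i. diameter (U i) \<le> \<delta>"
  shows "hausdorff_premeasure s \<delta> A \<le> (\<Sum>i. ennreal (diameter (U i) powr s))"
  unfolding hausdorff_premeasure_def using assms by (intro INF_lower) auto

lemma hausdorff_premeasure_lessD:
  assumes "hausdorff_premeasure s \<delta> A < e"
  obtains U where "A \<subseteq> (\<Union>i. U i)" "\<And>i. bounded (U i)" "\<And>i. diameter (U i) \<le> \<delta>"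
    "(\<Sum>i. ennreal (diameter (U i) powr s)) < e"
  using assms unfolding hausdorff_premeasure_def by (auto simp: INF_less_iff)

lemma hausdorff_premeasure_UN_null:
  fixes A :: "nat \<Rightarrow> 'a::metric_space set"
  assumes "\<And>n. hausdorff_premeasure s \<delta> (A n) = 0"
  shows "hausdorff_premeasure s \<delta> (\<Union>n. A n) = 0"
proof -
  have "hausdorff_premeasure s \<delta> (\<Union>n. A n) \<le> ennreal e" if e: "0 < e" for e :: real
  proof -
    have "\<exists>U. A n \<subseteq> (\<Union>i. U i) \<and> (\<forall>i. bounded (U i) \<and> diameter (U i) \<le> \<delta>) \<and>
            (\<Sum>i. ennreal (diameter (U i) powr s)) < ennreal (e * (1/2)^Suc n)" for n
      using hausdorff_premeasure_lessD[of s \<delta> "A n" "ennreal (e * (1/2)^Suc n)"] assms[of n] e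
      by (metis ennreal_less_zero_iff mult_pos_pos half_gt_zero_iff zero_less_one zero_less_power)
    then obtain U where U: "\<And>n. A n \<subseteq> (\<Union>i. U n i)" "\<And>n i. bounded (U n i)" "\<And>n i. diameter (U n i) \<le> \<delta>"
       "\<And>n. (\<Sum>i. ennreal (diameter (U n i) powr s)) < ennreal (e * (1/2)^Suc n)"
      by metis
    define g where "g = (\<lambda>p. ennreal (diameter (U (fst p) (snd p)) powr s))"
    define V where "V = (\<lambda>k. case prod_decode k of (n, i) \<Rightarrow> U n i)"
    have "hausdorff_premeasure s \<delta> (\<Union>n. A n) \<le> (\<Sum>k. ennreal (diameter (V k) powr s))"
    proof (rule hausdorff_premeasure_le)
      show "(\<Union>n. A n) \<subseteq> (\<Union>k. V k)"
      proof
        fix x assume "x \<in> (\<Union>n. A n)"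
        then obtain n i where "x \<in> U n i" using U(1) by blast
        then have "x \<in> V (prod_encode (n, i))" by (simp add: V_def)
        then show "x \<in> (\<Union>k. V k)" by blast
      qed
    qed (auto simp: V_def U split: prod.splits)
    also have "\<dots> = (\<Sum>k. g (prod_decode k))"
      by (intro suminf_cong) (simp add: V_def g_def split: prod.split)
    also have "\<dots> = (\<Sum>n. \<Sum>i. g (n, i))"
      by (rule suminf_ennreal_2dimen) (rule refl)
    also have "\<dots> \<le> (\<Sum>n. ennreal (e * (1/2)^Suc n))"
      using U(4) by (intro suminf_le summableI) (auto simp: g_def intro: less_imp_le)
    also have "\<dots> = ennreal e"
    proof -
      have "(\<lambda>n. e * (1/2)^Suc n) sums (e * 1)"
        using power_half_series by (intro sums_mult)
      then show ?thesis using e by (subst suminf_ennreal2) (auto simp: sums_iff)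
    qed
    finally show ?thesis .
  qed
  then show ?thesis
    by (metis ennreal_zero_less_top field_lbound_gt_zero le_zero_eq linorder_not_le zero_less_one
        ennreal_le_epsilon add_0)
qed

lemma hausdorff_premeasure_mono:
  assumes "A \<subseteq> B"
  shows "hausdorff_premeasure s \<delta> A \<le> hausdorff_premeasure s \<delta> B"
  unfolding hausdorff_premeasure_def using assms by (intro INF_superset_mono) auto

text \<open>
  The unit square is covered by \<open>n^2\<close> squares of diameter at most \<open>2 / n\<close>, and \<open>n^2 (2 / n)^s\<close> tends to 0 since \<open>s > 2\<close>.
\<close>
lemma hausdorff_premeasure_unit_square_null:
  assumes s: "2 < s" and \<delta>: "0 < \<delta>"
  shows "hausdorff_premeasure s \<delta> (cbox a (a + Complex 1 1)) = 0"
proof -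
  define g where "g = (\<lambda>n::nat. 2 powr s * real n powr (2 - s))"
  have le: "hausdorff_premeasure s \<delta> (cbox a (a + Complex 1 1)) \<le> ennreal (g n)"
    if n: "n > 0" "2 / real n \<le> \<delta>" for n :: nat
  proof -
    define q where "q = (\<lambda>k. a + Complex (real (k div n) / real n) (real (k mod n) / real n))"
    define Q where "Q = (\<lambda>k. if k < n * n then cbox (q k) (q k + Complex (1/n) (1/n)) else {})"
    have d: "diameter (Q k) \<le> 2 / real n" for k
    proof (cases "k < n * n")
      case True
      have "diameter (cbox (q k) (q k + Complex (1/n) (1/n))) \<le> 2 / real n"
      proof (rule diameter_le)
        fix x y assume xy: "x \<in> cbox (q k) (q k + Complex (1/n) (1/n))" "y \<in> cbox (q k) (q k + Complex (1/n) (1/n))"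
        have "\<bar>Re (x - y)\<bar> \<le> 1/n" "\<bar>Im (x - y)\<bar> \<le> 1/n" using xy by (auto simp: in_cbox_complex_iff)
        then show "cmod (x - y) \<le> 2 / real n" using cmod_le[of "x - y"] by simp
      qed auto
      then show ?thesis using True by (simp add: Q_def)
    qed (simp add: Q_def)
    have bd: "bounded (Q k)" for k by (simp add: Q_def)
    have "hausdorff_premeasure s \<delta> (cbox a (a + Complex 1 1)) \<le> (\<Sum>k. ennreal (diameter (Q k) powr s))"
    proof (rule hausdorff_premeasure_le)
      show "cbox a (a + Complex 1 1) \<subseteq> (\<Union>k. Q k)"
      proof
        fix z assume z: "z \<in> cbox a (a + Complex 1 1)"
        have cell: "\<exists>i<n. real i / real n \<le> x \<and> x \<le> real i / real n + 1 / real n" if "0 \<le> x" "x \<le> 1" for x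
        proof (cases "x = 1")
          case True
          then show ?thesis using n by (intro exI[of _ "n - 1"]) (auto simp: field_simps of_nat_diff)
        next
          case False
          define i where "i = nat \<lfloor>x * real n\<rfloor>"
          have i: "real i \<le> x * real n" "x * real n < real i + 1"
            using that n by (auto simp: i_def)
          moreover have "x * real n < 1 * real n" using False that n by (intro mult_strict_right_mono) auto
          ultimately have "i < n" by linarith
          then show ?thesis using i n by (intro exI[of _ i]) (auto simp: field_simps)
        qed
        obtain i where i: "i < n" "real i / real n \<le> Re (z - a)" "Re (z - a) \<le> real i / real n + 1 / real n"
          using cell[of "Re (z - a)"] z by (auto simp: in_cbox_complex_iff)
        obtain j where j: "j < n" "real j / real n \<le> Im (z - a)" "Im (z - a) \<le> real j / real n + 1 / real n"
          using cell[of "Im (z - a)"] z by (auto simp: in_cbox_complex_iff)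
        have "i * n + j < Suc i * n" using j by simp
        also have "\<dots> \<le> n * n" using i by (intro mult_right_mono) auto
        finally have "z \<in> Q (i * n + j)"
          using i j by (auto simp: Q_def q_def in_cbox_complex_iff)
        then show "z \<in> (\<Union>k. Q k)" by blast
      qed
      show "diameter (Q k) \<le> \<delta>" for k using d[of k] n by linarith
    qed (rule bd)
    also have "\<dots> = (\<Sum>k<n*n. ennreal (diameter (Q k) powr s))"
      by (intro suminf_finite) (auto simp: Q_def)
    also have "\<dots> \<le> (\<Sum>k<n*n. ennreal ((2 / real n) powr s))"
      using d s bd by (intro sum_mono ennreal_leI powr_mono2) (auto simp: diameter_ge_0)
    also have "\<dots> = ennreal (real (n * n) * (2 / real n) powr s)"
      by (simp add: ennreal_of_nat_eq_real_of_nat ennreal_mult)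
    also have "real (n * n) * (2 / real n) powr s = g n"
      using n by (simp add: g_def powr_divide powr_diff power2_eq_square)
    finally show ?thesis .
  qed
  have "g \<longlonglongrightarrow> 2 powr s * 0"
    unfolding g_def using s by (intro tendsto_mult tendsto_const tendsto_neg_powr filterlim_real_sequentially) auto
  then have "(\<lambda>n. ennreal (g n)) \<longlonglongrightarrow> ennreal 0" by (intro tendsto_ennrealI) simp
  moreover have "eventually (\<lambda>n. hausdorff_premeasure s \<delta> (cbox a (a + Complex 1 1)) \<le> ennreal (g n)) sequentially"
    using eventually_ge_at_top[of "nat \<lceil>2 / \<delta>\<rceil> + 1"]
  proof eventually_elim
    case (elim n)
    then have "2 / \<delta> \<le> real n" "n > 0" by linarith+
    then show ?case using \<delta> by (intro le) (auto simp: field_simps)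
  qed
  ultimately have "hausdorff_premeasure s \<delta> (cbox a (a + Complex 1 1)) \<le> ennreal 0"
    by (intro tendsto_lowerbound[of _ _ sequentially]) auto
  then show ?thesis by simp
qed

lemma hausdorff_measure_null_of_gt_2:
  fixes A :: "complex set"
  assumes s: "2 < s"
  shows "hausdorff_measure s A = 0"
proof -
  have "hausdorff_premeasure s \<delta> A = 0" if \<delta>: "0 < \<delta>" for \<delta>
  proof -
    define a where "a = (\<lambda>k. let (m, n) = from_nat k :: int \<times> int in Complex (of_int m) (of_int n))"
    have "A \<subseteq> (\<Union>k. cbox (a k) (a k + Complex 1 1))"
    proof
      fix z
      have "z \<in> cbox (a (to_nat (\<lfloor>Re z\<rfloor>, \<lfloor>Im z\<rfloor>))) (a (to_nat (\<lfloor>Re z\<rfloor>, \<lfloor>Im z\<rfloor>)) + Complex 1 1)"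
        by (auto simp: a_def in_cbox_complex_iff intro: less_imp_le)
      then show "z \<in> (\<Union>k. cbox (a k) (a k + Complex 1 1))" by blast
    qed
    then have "hausdorff_premeasure s \<delta> A \<le> hausdorff_premeasure s \<delta> (\<Union>k. cbox (a k) (a k + Complex 1 1))"
      by (rule hausdorff_premeasure_mono)
    also have "\<dots> = 0"
      by (rule hausdorff_premeasure_UN_null) (rule hausdorff_premeasure_unit_square_null[OF s \<delta>])
    finally show ?thesis by simp
  qed
  then show ?thesis unfolding hausdorff_measure_def by (auto simp: SUP_eq_iff)
qed

text \<open>
  Passing to open sets makes covers accessible to compactness.
\<close>
lemma open_superset_diameter_powr:
  fixes U :: "'a::real_normed_vector set"
  assumes U: "bounded U" and s: "0 < s" and e: "0 < e"
  obtains V where "open V" "bounded V" "U \<subseteq> V" "diameter V powr s \<le> diameter U powr s + e"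
proof -
  define d where "d = diameter U"
  have d0: "d \<ge> 0" using U by (simp add: d_def diameter_ge_0)
  have "((\<lambda>t. (d + 2 * t) powr s) \<longlongrightarrow> (d + 2 * 0) powr s) (at_right 0)"
    using s d0 by (intro tendsto_powr2 tendsto_intros) (auto simp: eventually_at_right_less intro!: eventually_at_rightI[of 0 1])
  then have "eventually (\<lambda>t. (d + 2 * t) powr s < d powr s + e) (at_right 0)"
    using e by (intro order_tendstoD(2)) auto
  then obtain b where b: "b > 0" "\<And>t. 0 < t \<Longrightarrow> t < b \<Longrightarrow> (d + 2 * t) powr s < d powr s + e"
    unfolding eventually_at_right_field by auto
  define t where "t = b / 2"
  have t: "0 < t" "(d + 2 * t) powr s < d powr s + e" using b(1) b(2)[of t] by (simp_all add: t_def)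
  define V where "V = (\<Union>u\<in>U. ball u t)"
  have dist: "norm (x - y) \<le> d + 2 * t" if "x \<in> V" "y \<in> V" for x y
  proof -
    obtain u v where uv: "u \<in> U" "v \<in> U" "dist u x < t" "dist v y < t" using \<open>x \<in> V\<close> \<open>y \<in> V\<close> by (auto simp: V_def)
    have "dist u v \<le> d" unfolding d_def using diameter_bounded_bound[OF U] uv by auto
    moreover have "dist x y \<le> dist u x + dist u v + dist v y" by metric
    ultimately have "dist x y \<le> d + 2 * t" using uv by linarith
    then show ?thesis by (simp add: dist_norm)
  qed
  have bV: "bounded V" unfolding bounded_two_points using dist by (auto simp: dist_norm)
  show ?thesis
  proof
    show "open V" by (auto simp: V_def)
    show "U \<subseteq> V" using t by (auto simp: V_def)
    show "bounded V" by (rule bV)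
    have "diameter V \<le> d + 2 * t" using dist d0 t by (intro diameter_le) auto
    then have "diameter V powr s \<le> (d + 2 * t) powr s" using s bV by (intro powr_mono2) (auto simp: diameter_ge_0)
    then show "diameter V powr s \<le> diameter U powr s + e" using t by (simp add: d_def)
  qed
qed

text \<open>
  A countable cover of \<open>A\<close> of small total cost can be enlarged to an open one at small cost.  Finitely many of
  its sets cover the compact intersection of the \<open>K n\<close>, hence already some \<open>K n\<close>, against the lower bound for
  finite covers.
\<close>
lemma hausdorff_measure_pos_of_content_ge:
  fixes K :: "nat \<Rightarrow> 'a::euclidean_space set"
  assumes s: "0 < s" and c: "0 < c"
    and comp: "\<And>n. compact (K n)" and dec: "\<And>m n. m \<le> n \<Longrightarrow> K n \<subseteq> K m"
    and cont: "\<And>n. content_ge s (K n) c"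
    and sub: "(\<Inter>n. K n) \<subseteq> A"
  shows "hausdorff_measure s A \<noteq> 0"
proof
  assume "hausdorff_measure s A = 0"
  then have "hausdorff_premeasure s 1 A \<le> 0"
    unfolding hausdorff_measure_def by (metis SUP_upper greaterThan_iff zero_less_one)
  then have "hausdorff_premeasure s 1 A < ennreal (c / 4)" using c by (simp add: ennreal_zero_less_divide)
  then obtain U where U: "A \<subseteq> (\<Union>i. U i)" "\<And>i. bounded (U i)"
      and sumU: "(\<Sum>i. ennreal (diameter (U i) powr s)) < ennreal (c / 4)"
    by (rule hausdorff_premeasure_lessD) blast
  have "\<exists>V. open V \<and> bounded V \<and> U i \<subseteq> V \<and> diameter V powr s \<le> diameter (U i) powr s + c/4 * (1/2)^Suc i" for i
    using open_superset_diameter_powr[OF U(2) s, of "c/4 * (1/2)^Suc i"] c by (metis mult_pos_pos divide_pos_pos zero_less_numeral zero_less_one zero_less_power)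
  then obtain V where V: "\<And>i. open (V i)" "\<And>i. bounded (V i)" "\<And>i. U i \<subseteq> V i"
      "\<And>i. diameter (V i) powr s \<le> diameter (U i) powr s + c/4 * (1/2)^Suc i" by metis
  have "compact (\<Inter>n. K n)" using comp by (intro compact_Inter) auto
  moreover have "(\<Inter>n. K n) \<subseteq> \<Union>(range V)"
  proof -
    have "(\<Union>i. U i) \<subseteq> \<Union>(range V)" using V(3) by (intro UN_mono subset_refl)
    with sub U(1) show ?thesis by (meson order_trans)
  qed
  moreover have "open B" if "B \<in> range V" for B using that V(1) by auto
  ultimately obtain D where D: "D \<subseteq> range V" "finite D" "(\<Inter>n. K n) \<subseteq> \<Union>D"
    by (meson compactE)
  then obtain I where I: "finite I" "D = V ` I" by (meson finite_subset_image)
  have opD: "open (\<Union>D)" using D V(1) by blast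
  obtain n where n: "K n \<subseteq> \<Union>D"
  proof (rule ccontr)
    assume "\<not> thesis"
    then have ne: "K n - \<Union>D \<noteq> {}" for n using that by blast
    have "(\<Inter>n. K n - \<Union>D) \<noteq> {}"
      by (intro compact_nest compact_diff comp opD ne Diff_mono dec subset_refl)
    then show False using D(3) by auto
  qed
  have "c \<le> (\<Sum>W\<in>D. diameter W powr s)"
    using n D V(2) I by (intro content_geD[OF cont]) auto
  also have "\<dots> \<le> (\<Sum>i\<in>I. diameter (V i) powr s)"
    unfolding I(2) by (rule sum_image_le[OF I(1), simplified o_def]) auto
  also have "\<dots> \<le> (\<Sum>i\<in>I. diameter (U i) powr s + c/4 * (1/2)^Suc i)"
    by (intro sum_mono V)
  also have "\<dots> = (\<Sum>i\<in>I. diameter (U i) powr s) + c/4 * (\<Sum>i\<in>I. (1/2)^Suc i)"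
    by (simp add: sum.distrib sum_distrib_left)
  also have "(\<Sum>i\<in>I. diameter (U i) powr s) \<le> c / 4"
  proof -
    have "ennreal (\<Sum>i\<in>I. diameter (U i) powr s) = (\<Sum>i\<in>I. ennreal (diameter (U i) powr s))"
      by (subst sum_ennreal) auto
    also have "\<dots> \<le> (\<Sum>i. ennreal (diameter (U i) powr s))"
      using I by (intro sum_le_suminf) auto
    also have "\<dots> \<le> ennreal (c / 4)" using sumU by simp
    finally show ?thesis using c by (subst (asm) ennreal_le_iff) auto
  qed
  also have "(\<Sum>i\<in>I. (1/2::real)^Suc i) \<le> 1"
    using I power_half_series sum_le_suminf[of "\<lambda>i. (1/2::real)^Suc i" I] by (auto simp: sums_iff)
  finally show False using c by simp
qed

lemma hausdorff_dim_eq_2I: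
  fixes A :: "complex set"
  assumes "\<And>s. 0 < s \<Longrightarrow> s < 2 \<Longrightarrow> hausdorff_measure s A \<noteq> 0"
  shows "hausdorff_dim A = 2"
proof (rule antisym)
  show "hausdorff_dim A \<le> 2"
  proof (rule ereal_le_epsilon2)
    fix e :: real assume e: "0 < e"
    have "hausdorff_dim A \<le> ereal (2 + e)"
      unfolding hausdorff_dim_def using e hausdorff_measure_null_of_gt_2[of "2 + e" A]
      by (intro INF_lower) auto
    then show "hausdorff_dim A \<le> 2 + ereal e" by simp
  qed
  show "2 \<le> hausdorff_dim A"
    unfolding hausdorff_dim_def
  proof (rule INF_greatest)
    fix s assume "s \<in> {s. 0 < s \<and> hausdorff_measure s A = 0}"
    then have "2 \<le> s" using assms[of s] by force
    then show "2 \<le> ereal s" by simp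
  qed
qed

section \<open>The function and its poles\<close>

text \<open>
  A Belyi map up to normalisation: of degree \<open>M + 1\<close> and unramified outside 0, infinity and its value at \<open>M + 1\<close>.
\<close>
definition belyi :: "nat \<Rightarrow> complex \<Rightarrow> complex" where
  "belyi M w = w ^ (M + 1) / (w - 1) ^ M"

text \<open>
  Division by zero gives the value 0 at the poles, as is required of a nicely meromorphic function if \<open>M \<ge> 1\<close>.
\<close>
definition belyi_exp_exp :: "nat \<Rightarrow> complex \<Rightarrow> complex" where
  "belyi_exp_exp M z = belyi M (exp (exp z))"

lemma belyi_has_field_derivative:
  assumes "w \<noteq> 1"
  shows "(belyi M has_field_derivative w ^ M * (w - of_nat (M + 1)) / (w - 1) ^ (M + 1)) (at w)"
proof (cases M)
  case 0
  have "((\<lambda>w. w) has_field_derivative 1) (at w)" by (rule DERIV_ident)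
  then show ?thesis using assms 0 by (simp add: belyi_def[abs_def])
next
  case (Suc m)
  have "((\<lambda>w. w ^ (M + 1) / (w - 1) ^ M) has_field_derivative
      (of_nat (M + 1) * w ^ M * (w - 1) ^ M - w ^ (M + 1) * (of_nat M * (w - 1) ^ m)) / ((w - 1) ^ M * (w - 1) ^ M)) (at w)"
  proof -
    have "((\<lambda>w. w ^ (M + 1)) has_field_derivative of_nat (M + 1) * w ^ M) (at w)"
      using DERIV_power[OF DERIV_ident[of "at w"], where n = "M + 1"] by simp
    moreover have "((\<lambda>w. (w - 1) ^ M) has_field_derivative of_nat M * (w - 1) ^ m) (at w)"
      using DERIV_power[OF DERIV_diff[OF DERIV_ident[of "at w"] DERIV_const[of 1]], where n = M] Suc by simp
    ultimately show ?thesis using assms by (intro DERIV_divide) auto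
  qed
  also have "(of_nat (M + 1) * w ^ M * (w - 1) ^ M - w ^ (M + 1) * (of_nat M * (w - 1) ^ m)) / ((w - 1) ^ M * (w - 1) ^ M)
     = w ^ M * (w - of_nat (M + 1)) / (w - 1) ^ (M + 1)"
  proof -
    define u where "u = w - 1"
    have u: "u \<noteq> 0" "w = u + 1" using assms by (auto simp: u_def)
    have "(of_nat (M + 1) * w ^ M * u ^ M - w ^ (M + 1) * (of_nat M * u ^ m)) * u ^ (M + 1)
       = w ^ M * (w - of_nat (M + 1)) * (u ^ M * u ^ M)"
      unfolding Suc by (simp add: u(2) algebra_simps)
    then show ?thesis unfolding u_def[symmetric] using u(1) by (simp add: frac_eq_eq)
  qed
  finally show ?thesis by (simp add: belyi_def[abs_def])
qed

lemma belyi_exp_exp_has_field_derivative: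
  assumes "exp (exp z) \<noteq> 1"
  shows "(belyi_exp_exp M has_field_derivative
           exp (exp z) ^ M * (exp (exp z) - of_nat (M + 1)) / (exp (exp z) - 1) ^ (M + 1) *
           (exp (exp z) * exp z)) (at z)"
proof -
  have "((\<lambda>z. exp (exp z)) has_field_derivative exp (exp z) * exp z) (at z)"
    by (auto intro!: derivative_eq_intros)
  from DERIV_chain2[OF belyi_has_field_derivative[OF assms] this] show ?thesis
    by (simp add: belyi_exp_exp_def[abs_def])
qed

lemma open_nonpoles: "open {z :: complex. exp (exp z) \<noteq> 1}"
  by (intro open_Collect_neq continuous_intros)

lemma belyi_exp_exp_holomorphic: "belyi_exp_exp M holomorphic_on {z. exp (exp z) \<noteq> 1}"
  using belyi_exp_exp_has_field_derivative[of _ M] open_nonpoles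
  by (auto simp: holomorphic_on_open)

lemma belyi_exp_exp_isCont: "exp (exp z) \<noteq> 1 \<Longrightarrow> isCont (belyi_exp_exp M) z"
  using belyi_exp_exp_has_field_derivative DERIV_isCont by blast

lemma belyi_exp_exp_not_pole: "exp (exp z) \<noteq> 1 \<Longrightarrow> \<not> is_pole (belyi_exp_exp M) z"
  by (rule not_is_pole_holomorphic[OF open_nonpoles _ belyi_exp_exp_holomorphic]) auto

text \<open>
  The function \<open>exp (exp z) - 1\<close> has only simple zeros, because its derivative \<open>exp (exp z) * exp z\<close> does not
  vanish.  Splitting off the factor \<open>z - a\<close> exhibits the order of the pole.
\<close>
lemma belyi_exp_exp_pole:
  assumes "exp (exp a) = 1" "M \<ge> 1"
  shows "is_pole (belyi_exp_exp M) a" "zorder (belyi_exp_exp M) a = - int M"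
proof -
  \<comment> \<open>The quotient \<open>k\<close> is holomorphic and does not vanish at \<open>a\<close>.\<close>
  define F where "F = (\<lambda>z::complex. exp (exp z))"
  define k where "k = (\<lambda>z. if z = a then deriv F a else (F z - F a) / (z - a))"
  have dF: "(F has_field_derivative exp (exp z) * exp z) (at z)" for z
    unfolding F_def by (auto intro!: derivative_eq_intros)
  have "F holomorphic_on UNIV" unfolding F_def by (intro holomorphic_intros)
  then have k: "k holomorphic_on UNIV"
    unfolding k_def by (rule pole_lemma) auto
  have ka: "k a \<noteq> 0" using DERIV_imp_deriv[OF dF, of a] by (simp add: k_def)
  define S where "S = {z. k z \<noteq> 0}"
  have S: "open S" "a \<in> S"
    using ka k unfolding S_def
    by (auto intro!: open_Collect_neq continuous_intros holomorphic_on_imp_continuous_on)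
  have kS: "k holomorphic_on S" using k by (rule holomorphic_on_subset) auto
  define g where "g = (\<lambda>z. F z ^ (M + 1) / k z ^ M)"
  have g: "g holomorphic_on S"
    unfolding g_def F_def using kS by (intro holomorphic_intros) (auto simp: S_def)
  have ga: "g a \<noteq> 0" using ka by (simp add: g_def F_def)
  have eq: "belyi_exp_exp M z = g z * (z - a) powi (- int M)" if "z \<noteq> a" for z
  proof -
    have "F z - 1 = k z * (z - a)" using that assms by (simp add: k_def F_def)
    moreover have "belyi_exp_exp M z = F z ^ (M + 1) / (F z - 1) ^ M"
      by (simp add: belyi_exp_exp_def belyi_def F_def)
    ultimately show ?thesis
      by (simp add: g_def power_mult_distrib power_int_minus divide_inverse mult.assoc)
  qed
  show "zorder (belyi_exp_exp M) a = - int M"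
    by (rule zorder_eqI[OF S g ga]) (use eq in auto)
  have "is_pole (\<lambda>z. g z / (z - a) ^ M) a"
  proof (rule is_pole_divide)
    show "isCont g a" using g S by (metis continuous_on_eq_continuous_at holomorphic_on_imp_continuous_on)
    show "filterlim (\<lambda>z. (z - a) ^ M) (at 0) (at a)"
      using assms by (auto intro!: filterlim_atI tendsto_eq_intros simp: eventually_at_filter)
  qed (rule ga)
  then show "is_pole (belyi_exp_exp M) a"
    by (rule is_pole_transform) (use eq in \<open>auto simp: eventually_at_filter power_int_minus divide_inverse\<close>)
qed

lemma is_pole_belyi_exp_exp_iff: "M \<ge> 1 \<Longrightarrow> is_pole (belyi_exp_exp M) z \<longleftrightarrow> exp (exp z) = 1"
  using belyi_exp_exp_pole(1) belyi_exp_exp_not_pole by blast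

lemma belyi_exp_exp_nicely_meromorphic:
  assumes "M \<ge> 1"
  shows "belyi_exp_exp M nicely_meromorphic_on UNIV"
  unfolding nicely_meromorphic_on_def
proof (intro conjI ballI)
  have "(\<lambda>z::complex. exp (exp z)) analytic_on UNIV" by (intro analytic_intros)
  then show "belyi_exp_exp M meromorphic_on UNIV"
    unfolding belyi_exp_exp_def[abs_def] belyi_def
    by (intro meromorphic_intros analytic_on_imp_meromorphic_on) auto
  fix z :: complex
  show "is_pole (belyi_exp_exp M) z \<and> belyi_exp_exp M z = 0 \<or> belyi_exp_exp M \<midarrow>z\<rightarrow> belyi_exp_exp M z"
  proof (cases "exp (exp z) = 1")
    case True
    then have "belyi_exp_exp M z = 0" using assms by (simp add: belyi_exp_exp_def belyi_def)
    with True show ?thesis using assms is_pole_belyi_exp_exp_iff by blast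
  next
    case False
    then show ?thesis using belyi_exp_exp_isCont isContD by blast
  qed
qed

lemma norm_belyi_ge:
  assumes "1 \<le> cmod w" "w \<noteq> 1"
  shows "cmod w / 2 ^ M \<le> cmod (belyi M w)"
proof -
  have "cmod (w - 1) \<le> 2 * cmod w" using norm_triangle_ineq4[of w 1] assms by simp
  then have "cmod (w - 1) ^ M \<le> (2 * cmod w) ^ M" by (intro power_mono) auto
  then have "cmod w * cmod (w - 1) ^ M \<le> cmod w * (2 * cmod w) ^ M" by (intro mult_left_mono) auto
  then show ?thesis using assms
    by (simp add: belyi_def norm_divide norm_mult norm_power field_simps power_mult_distrib)
qed

lemma belyi_exp_exp_at_infinity_real: "filterlim (\<lambda>s. belyi_exp_exp M (of_real s)) at_infinity at_top"
proof -
  have "filterlim (\<lambda>s::real. exp (exp s) / 2 ^ M) at_top at_top"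
    by (intro filterlim_at_top_mult_tendsto_pos[OF tendsto_const, of "inverse (2^M)", simplified divide_inverse[symmetric]]
       filterlim_compose[OF exp_at_top] exp_at_top) auto
  then have "filterlim (\<lambda>s. norm (belyi_exp_exp M (of_real s))) at_top at_top"
  proof (rule filterlim_at_top_mono, intro always_eventually allI)
    fix s :: real
    have "exp (exp (complex_of_real s)) = of_real (exp (exp s))" by (simp add: exp_of_real)
    moreover have "exp (exp s) > 1" by simp
    ultimately show "exp (exp s) / 2 ^ M \<le> norm (belyi_exp_exp M (of_real s))"
      using norm_belyi_ge[of "exp (exp (complex_of_real s))" M]
      by (simp add: belyi_exp_exp_def del: exp_of_real)
  qed
  then show ?thesis by (rule filterlim_at_infinity_conv_norm_at_top[THEN iffD2])
qed

text \<open>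
  The function has the period \<open>2 \<pi> \<i>\<close>.  A rational function with this property takes the value at 0 infinitely
  often and is therefore constant, but here the values are unbounded on the real axis.
\<close>
lemma belyi_exp_exp_not_rational: "\<not> rational_function (belyi_exp_exp M)"
proof
  assume "rational_function (belyi_exp_exp M)"
  then obtain p q where q: "q \<noteq> 0" and pq: "\<And>z. poly q z \<noteq> 0 \<Longrightarrow> belyi_exp_exp M z = poly p z / poly q z"
    unfolding rational_function_def by blast
  define c where "c = belyi_exp_exp M 0"
  \<comment> \<open>Infinitely many points where the value at 0 is taken.\<close>
  define Z where "Z = range (\<lambda>n::nat. 2 * of_real pi * \<i> * of_nat n)"
  have "inj (\<lambda>n::nat. 2 * complex_of_real pi * \<i> * of_nat n)" by (auto simp: inj_def)
  then have "infinite Z" unfolding Z_def by (rule range_inj_infinite)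
  have per: "belyi_exp_exp M z = c" if "z \<in> Z" for z
  proof -
    obtain n where n: "z = 2 * of_real pi * \<i> * of_nat n" using \<open>z \<in> Z\<close> unfolding Z_def by blast
    have "exp z = exp (0 :: complex)" unfolding n exp_eq by (intro exI[of _ "int n"]) simp
    then show ?thesis by (simp add: c_def belyi_exp_exp_def)
  qed
  have fin: "finite {z. poly q z = 0}" using q by (rule poly_roots_finite)
  have "Z - {z. poly q z = 0} \<subseteq> {z. poly (p - smult c q) z = 0}"
  proof safe
    fix z assume z: "z \<in> Z" "poly q z \<noteq> 0"
    then have "c = poly p z / poly q z" using pq per by metis
    then show "poly (p - smult c q) z = 0" using z by (simp add: field_simps)
  qed
  then have "infinite {z. poly (p - smult c q) z = 0}"
    using \<open>infinite Z\<close> fin by (metis Diff_infinite_finite infinite_super)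
  then have "p - smult c q = 0" using poly_roots_finite by blast
  then have const: "belyi_exp_exp M z = c" if "poly q z \<noteq> 0" for z using pq[OF that] that by simp
  have "finite {s::real. poly q (of_real s) = 0}"
    using finite_vimageI[OF fin, of complex_of_real] by (simp add: vimage_def inj_def)
  then have "bounded {s::real. poly q (of_real s) = 0}" by (rule finite_imp_bounded)
  then obtain B where B: "\<And>s::real. poly q (of_real s) = 0 \<Longrightarrow> \<bar>s\<bar> \<le> B"
    unfolding bounded_iff by auto
  have "eventually (\<lambda>s::real. belyi_exp_exp M (of_real s) = c) at_top"
    using eventually_gt_at_top[of B] by eventually_elim (use B const in force)
  moreover have "eventually (\<lambda>s::real. norm (belyi_exp_exp M (of_real s)) \<ge> norm c + 1) at_top"
    using belyi_exp_exp_at_infinity_real[of M] unfolding filterlim_at_infinity_conv_norm_at_top filterlim_at_top by blast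
  ultimately have "eventually (\<lambda>s::real. False) at_top" by eventually_elim auto
  then show False by simp
qed

lemma belyi_exp_exp_transcendental: "M \<ge> 1 \<Longrightarrow> transcendental_meromorphic (belyi_exp_exp M)"
  using belyi_exp_exp_nicely_meromorphic belyi_exp_exp_not_rational by (simp add: transcendental_meromorphic_def)

section \<open>Singular values\<close>

lemma limitin_riemann_sphere_None:
  assumes "filterlim (\<lambda>s. f (\<gamma> s)) at_infinity F"
  shows "limitin riemann_sphere (\<lambda>s. sphere_map f (\<gamma> s)) None F"
  unfolding limitin_def
proof (intro conjI allI impI)
  show "None \<in> topspace riemann_sphere" by (simp add: riemann_sphere_def)
  fix V assume "openin riemann_sphere V \<and> None \<in> V"
  then obtain C where C: "compact C" "V = insert None (Some ` (UNIV - C))"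
    by (auto simp: riemann_sphere_def openin_Alexandroff_compactification)
  then obtain B where B: "\<And>x. x \<in> C \<Longrightarrow> norm x \<le> B"
    using compact_imp_bounded bounded_iff by metis
  have "eventually (\<lambda>s. norm (f (\<gamma> s)) \<ge> B + 1) F"
    using assms unfolding filterlim_at_infinity_conv_norm_at_top filterlim_at_top by blast
  then show "eventually (\<lambda>s. sphere_map f (\<gamma> s) \<in> V) F"
  proof eventually_elim
    case (elim s)
    then have "f (\<gamma> s) \<notin> C" using B[of "f (\<gamma> s)"] by auto
    then show ?case by (auto simp: C sphere_map_def)
  qed
qed

lemma limitin_riemann_sphere_Some_iff:
  "limitin riemann_sphere (\<lambda>s. sphere_map f (\<gamma> s)) (Some w) F \<longleftrightarrow>
     eventually (\<lambda>s. \<not> is_pole f (\<gamma> s)) F \<and> ((\<lambda>s. f (\<gamma> s)) \<longlongrightarrow> w) F"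
proof
  assume L: "limitin riemann_sphere (\<lambda>s. sphere_map f (\<gamma> s)) (Some w) F"
  have ev: "eventually (\<lambda>s. \<not> is_pole f (\<gamma> s) \<and> f (\<gamma> s) \<in> U) F" if "open U" "w \<in> U" for U
  proof -
    have "openin riemann_sphere (Some ` U)" using that by (simp add: riemann_sphere_def)
    then have "eventually (\<lambda>s. sphere_map f (\<gamma> s) \<in> Some ` U) F"
      using L that unfolding limitin_def by blast
    then show ?thesis by eventually_elim (auto simp: sphere_map_def split: if_splits)
  qed
  show "eventually (\<lambda>s. \<not> is_pole f (\<gamma> s)) F \<and> ((\<lambda>s. f (\<gamma> s)) \<longlongrightarrow> w) F"
    using ev[of UNIV] by (auto intro!: topological_tendstoI eventually_mono[OF ev])
next
  assume R: "eventually (\<lambda>s. \<not> is_pole f (\<gamma> s)) F \<and> ((\<lambda>s. f (\<gamma> s)) \<longlongrightarrow> w) F"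
  show "limitin riemann_sphere (\<lambda>s. sphere_map f (\<gamma> s)) (Some w) F"
    unfolding limitin_def
  proof (intro conjI allI impI)
    show "Some w \<in> topspace riemann_sphere" by (simp add: riemann_sphere_def)
    fix V assume V: "openin riemann_sphere V \<and> Some w \<in> V"
    have "openin euclidean {x. Some x \<in> V}"
      using openin_continuous_map_preimage[OF continuous_map_Some, of euclidean V] V by (simp add: riemann_sphere_def)
    then have "open {x. Some x \<in> V}" by simp
    with R V have "eventually (\<lambda>s. f (\<gamma> s) \<in> {x. Some x \<in> V}) F"
      by (intro topological_tendstoD) auto
    then show "eventually (\<lambda>s. sphere_map f (\<gamma> s) \<in> V) F"
      using R by (auto simp: sphere_map_def elim: eventually_elim2)
  qed
qed

text \<open>
  Far out, the curve stays in the union of small disjoint discs about the zeros of \<open>P\<close>, because \<open>P\<close> is bounded away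
  from 0 on the compact remainder; being connected, it stays in one of them.
\<close>
lemma path_converges_to_zero:
  fixes \<gamma> :: "real \<Rightarrow> complex" and P :: "complex \<Rightarrow> complex"
  assumes \<gamma>: "continuous_on {t0..} \<gamma>" and C: "compact C" "eventually (\<lambda>s. \<gamma> s \<in> C) at_top"
    and P: "continuous_on C P" and Z: "finite {z. P z = 0}"
    and lim: "((\<lambda>s. P (\<gamma> s)) \<longlongrightarrow> 0) at_top"
  obtains r where "P r = 0" "(\<gamma> \<longlongrightarrow> r) at_top"
proof -
  define Z where "Z = {z. P z = 0}"
  obtain e0 where e0: "e0 > 0" "\<And>x y. x \<in> Z \<Longrightarrow> y \<in> Z \<Longrightarrow> dist x y < e0 \<Longrightarrow> x = y"
  proof -
    have "uniform_discrete Z" using assms(5) uniform_discrete_finite_iff[of Z] by (simp add: Z_def)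
    then show ?thesis using that unfolding uniform_discrete_def by auto
  qed
  have near: "eventually (\<lambda>s. \<gamma> s \<in> (\<Union>z\<in>Z. ball z e)) at_top" if e: "e > 0" for e
  proof -
    define K where "K = C - (\<Union>z\<in>Z. ball z e)"
    have K: "compact K" unfolding K_def using C by (intro compact_diff) auto
    obtain d where d: "d > 0" "\<And>z. z \<in> K \<Longrightarrow> d \<le> norm (P z)"
    proof (cases "K = {}")
      case False
      have "continuous_on K (\<lambda>z. norm (P z))"
        by (intro continuous_on_norm continuous_on_subset[OF P]) (auto simp: K_def)
      then obtain z0 where z0: "z0 \<in> K" "\<And>z. z \<in> K \<Longrightarrow> norm (P z0) \<le> norm (P z)"
        using continuous_attains_inf[OF K False] by blast
      have "z0 \<notin> Z" using z0(1) e by (auto simp: K_def)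
      then have "norm (P z0) > 0" by (simp add: Z_def)
      then show ?thesis using z0(2) by (rule that)
    qed (use that[of 1] in auto)
    have "eventually (\<lambda>s. norm (P (\<gamma> s)) < d) at_top"
      using lim d(1) by (simp add: tendsto_iff)
    with C(2) show ?thesis
    proof eventually_elim
      case (elim s)
      then have "\<gamma> s \<notin> K" using d(2)[of "\<gamma> s"] by auto
      then show ?case using elim by (auto simp: K_def)
    qed
  qed
  obtain s0 where s0: "s0 \<ge> t0" "\<And>s. s \<ge> s0 \<Longrightarrow> \<gamma> s \<in> (\<Union>z\<in>Z. ball z (e0 / 2))"
    using near[of "e0 / 2"] e0(1) unfolding eventually_at_top_linorder
    by (metis half_gt_zero max.bounded_iff max.cobounded1)
  obtain r where r: "r \<in> Z" "\<gamma> s0 \<in> ball r (e0 / 2)" using s0 by auto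
  have disj: "ball r (e0 / 2) \<inter> ball z (e0 / 2) = {}" if "z \<in> Z" "z \<noteq> r" for z
  proof (rule ccontr)
    assume "ball r (e0 / 2) \<inter> ball z (e0 / 2) \<noteq> {}"
    then obtain x where "dist r x < e0 / 2" "dist z x < e0 / 2" by auto
    then have "dist z r < e0" using dist_triangle_less_add[of z x "e0/2" r "e0/2"] by (simp add: dist_commute)
    then show False using e0 that r by auto
  qed
  have conn: "connected (\<gamma> ` {s0..})"
    using \<gamma> s0(1) by (intro connected_continuous_image continuous_on_subset[OF \<gamma>]) auto
  have inr: "\<gamma> s \<in> ball r (e0 / 2)" if s: "s \<ge> s0" for s
  proof (rule ccontr)
    assume "\<gamma> s \<notin> ball r (e0 / 2)"
    then have "\<gamma> s \<in> (\<Union>z\<in>Z - {r}. ball z (e0 / 2))" using s0(2)[OF s] by auto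
    moreover have "\<gamma> s0 \<in> ball r (e0 / 2)" by (rule r)
    moreover have "\<gamma> ` {s0..} \<subseteq> ball r (e0 / 2) \<union> (\<Union>z\<in>Z - {r}. ball z (e0 / 2))"
      using s0(2) by blast
    moreover have "ball r (e0 / 2) \<inter> (\<Union>z\<in>Z - {r}. ball z (e0 / 2)) = {}" using disj by auto
    moreover have "open (\<Union>z\<in>Z - {r}. ball z (e0 / 2))" by auto
    ultimately show False
      using connectedD[OF conn open_ball, of "\<Union>z\<in>Z - {r}. ball z (e0 / 2)" r "e0/2"] s
      by (metis IntI Int_empty_left atLeast_iff empty_iff imageI order_refl)
  qed
  have "(\<gamma> \<longlongrightarrow> r) at_top"
  proof (rule tendstoI)
    fix e :: real assume e: "e > 0"
    have "eventually (\<lambda>s. \<gamma> s \<in> (\<Union>z\<in>Z. ball z (min e (e0/2)))) at_top"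
      using e e0 by (intro near) auto
    then show "eventually (\<lambda>s. dist (\<gamma> s) r < e) at_top"
      using eventually_ge_at_top[of s0]
    proof eventually_elim
      case (elim s)
      then obtain z where z: "z \<in> Z" "dist z (\<gamma> s) < min e (e0 / 2)" by auto
      then have "\<gamma> s \<in> ball r (e0 / 2) \<inter> ball z (e0 / 2)" using inr[OF elim(2)] by simp
      then have "z = r" using disj[OF z(1)] by blast
      then show ?case using z by (simp add: dist_commute)
    qed
  qed
  then show ?thesis using r that by (auto simp: Z_def)
qed

text \<open>
  Lifting of limits along the covering \<open>exp\<close>: the curve differs from a convergent branch of the logarithm by a
  continuous function with values in a discrete set, that is, by a constant.
\<close>
lemma path_exp_converges:
  fixes \<gamma> :: "real \<Rightarrow> complex"
  assumes \<gamma>: "continuous_on {t0..} \<gamma>" and r: "r \<noteq> 0" and lim: "((\<lambda>s. exp (\<gamma> s)) \<longlongrightarrow> r) at_top"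
  obtains l where "exp l = r" "(\<gamma> \<longlongrightarrow> l) at_top"
proof -
  have lim1: "((\<lambda>s. exp (\<gamma> s) / r) \<longlongrightarrow> 1) at_top"
    using tendsto_divide[OF lim tendsto_const r] r by simp
  then have "eventually (\<lambda>s. dist (exp (\<gamma> s) / r) 1 < 1) at_top" by (rule tendstoD) simp
  then obtain s0 where s0: "s0 \<ge> t0" "\<And>s. s \<ge> s0 \<Longrightarrow> dist (exp (\<gamma> s) / r) 1 < 1"
    unfolding eventually_at_top_linorder by (metis max.bounded_iff max.cobounded1)
  have nonneg: "exp (\<gamma> s) / r \<notin> \<real>\<^sub>\<le>\<^sub>0" if "s \<ge> s0" for s
  proof
    assume "exp (\<gamma> s) / r \<in> \<real>\<^sub>\<le>\<^sub>0"
    then have "Re (exp (\<gamma> s) / r) \<le> 0" by (simp add: complex_nonpos_Reals_iff)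
    moreover have "\<bar>Re (exp (\<gamma> s) / r - 1)\<bar> < 1"
      using s0(2)[OF that] abs_Re_le_cmod[of "exp (\<gamma> s) / r - 1"] by (simp add: dist_norm)
    ultimately show False by simp
  qed
  \<comment> \<open>Near 1 the principal branch of the logarithm is continuous.\<close>
  define L where "L = (\<lambda>s. Ln (exp (\<gamma> s) / r))"
  define D where "D = (\<lambda>s. \<gamma> s - L s)"
  have \<gamma>': "continuous_on {s0..} \<gamma>" using \<gamma> s0(1) by (elim continuous_on_subset) auto
  have contD: "continuous_on {s0..} D"
    unfolding D_def L_def using nonneg r by (intro continuous_intros \<gamma>') auto
  have expD: "exp (D s) = r" for s
    using r by (simp add: D_def L_def exp_diff)
  have "D constant_on {s0..}"
  proof (rule continuous_discrete_range_constant[OF _ contD])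
    fix x :: real assume "x \<in> {s0..}"
    have "2 * pi \<le> norm (D y - D x)" if "D y \<noteq> D x" for y
    proof -
      have "exp (D y) = exp (D x)" by (simp add: expD)
      then obtain n where n: "D y = D x + of_int (2 * n) * pi * \<i>" unfolding exp_eq by auto
      then have "n \<noteq> 0" using that by auto
      then have "1 \<le> \<bar>real_of_int n\<bar>" by linarith
      moreover have "norm (D y - D x) = 2 * \<bar>real_of_int n\<bar> * pi" using n by (simp add: norm_mult)
      ultimately show ?thesis by simp
    qed
    then show "\<exists>e>0. \<forall>y. y \<in> {s0..} \<and> D y \<noteq> D x \<longrightarrow> e \<le> norm (D y - D x)"
      by (intro exI[of _ "2 * pi"]) auto
  qed (simp add: connected_Ici)
  then obtain l where l: "\<And>s. s \<ge> s0 \<Longrightarrow> D s = l" unfolding constant_on_def by auto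
  have "exp l = r" using l[of s0] expD[of s0] by simp
  moreover have "(\<gamma> \<longlongrightarrow> l) at_top"
  proof -
    have "(L \<longlongrightarrow> Ln 1) at_top" unfolding L_def by (intro tendsto_Ln lim1) auto
    then have "((\<lambda>s. l + L s) \<longlongrightarrow> l + Ln 1) at_top" by (intro tendsto_intros)
    then have "((\<lambda>s. l + L s) \<longlongrightarrow> l) at_top" by simp
    then show ?thesis
    proof (rule Lim_transform_eventually)
      show "eventually (\<lambda>s. l + L s = \<gamma> s) at_top"
        using eventually_ge_at_top[of s0] by eventually_elim (simp add: l[symmetric] D_def)
    qed
  qed
  ultimately show ?thesis using that by blast
qed

text \<open>
  Suppose that \<open>f\<close> tends to a finite \<open>w \<noteq> 0\<close> along the curve.  Then \<open>W = exp (exp \<gamma>)\<close> stays bounded and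
  tends to a root \<open>r\<close> of \<open>x^(M+1) - w (x-1)^M\<close>.  As \<open>r \<noteq> 0\<close>, the limit lifts to \<open>exp \<gamma> \<longrightarrow> l\<close> with \<open>exp l = r\<close>,
  and as \<open>r \<noteq> 1\<close> gives \<open>l \<noteq> 0\<close>, it lifts once more to a finite limit of \<open>\<gamma>\<close>.
\<close>
lemma not_asymptotic_value_belyi_exp_exp:
  fixes \<gamma> :: "real \<Rightarrow> complex"
  assumes M: "M \<ge> 1" and w: "w \<noteq> 0"
    and \<gamma>: "continuous_on {0..} \<gamma>" "filterlim \<gamma> at_infinity at_top"
    and np: "eventually (\<lambda>s. \<not> is_pole (belyi_exp_exp M) (\<gamma> s)) at_top"
    and lim: "((\<lambda>s. belyi_exp_exp M (\<gamma> s)) \<longlongrightarrow> w) at_top"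
  shows False
proof -
  define W where "W = (\<lambda>s. exp (exp (\<gamma> s)))"
  define P where "P = (\<lambda>x. x ^ (M + 1) - w * (x - 1) ^ M)"
  define B where "B = max 1 (2 ^ M * (norm w + 1))"
  have contE: "continuous_on {0..} (\<lambda>s. exp (\<gamma> s))" using \<gamma>(1) by (rule continuous_on_exp)
  have contW: "continuous_on {0..} W" unfolding W_def using contE by (rule continuous_on_exp)
  have W1: "eventually (\<lambda>s. W s \<noteq> 1) at_top"
    using np M by (simp add: is_pole_belyi_exp_exp_iff W_def)
  have bdd: "eventually (\<lambda>s. W s \<in> cball 0 B) at_top"
  proof -
    have "eventually (\<lambda>s. dist (belyi_exp_exp M (\<gamma> s)) w < 1) at_top" using lim by (rule tendstoD) simp
    with W1 show ?thesis
    proof eventually_elim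
      case (elim s)
      have "norm (belyi_exp_exp M (\<gamma> s)) \<le> norm w + 1"
        using elim(2) norm_triangle_ineq2[of "belyi_exp_exp M (\<gamma> s)" w] by (simp add: dist_norm)
      moreover have "norm (W s) \<le> 2 ^ M * norm (belyi_exp_exp M (\<gamma> s))" if "1 \<le> norm (W s)"
        using norm_belyi_ge[OF that elim(1), of M] by (simp add: belyi_exp_exp_def W_def field_simps)
      ultimately have "norm (W s) \<le> 2 ^ M * (norm w + 1)" if "1 \<le> norm (W s)"
        using that by (meson mult_left_mono order_trans zero_le_numeral zero_le_power)
      then show ?case unfolding B_def by (cases "1 \<le> norm (W s)") auto
    qed
  qed
  have limP: "((\<lambda>s. P (W s)) \<longlongrightarrow> 0) at_top"
  proof (rule Lim_null_comparison)
    have "((\<lambda>s. norm (belyi_exp_exp M (\<gamma> s) - w) * (B + 1) ^ M) \<longlongrightarrow> norm (w - w) * (B + 1) ^ M) at_top"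
      by (intro tendsto_intros lim)
    then show "((\<lambda>s. norm (belyi_exp_exp M (\<gamma> s) - w) * (B + 1) ^ M) \<longlongrightarrow> 0) at_top" by simp
    show "eventually (\<lambda>s. norm (P (W s)) \<le> norm (belyi_exp_exp M (\<gamma> s) - w) * (B + 1) ^ M) at_top"
      using W1 bdd
    proof eventually_elim
      case (elim s)
      have "P (W s) = (belyi_exp_exp M (\<gamma> s) - w) * (W s - 1) ^ M"
        using elim by (simp add: P_def belyi_exp_exp_def belyi_def W_def field_simps)
      moreover have "norm (W s - 1) \<le> B + 1" using elim norm_triangle_ineq4[of "W s" 1] by simp
      ultimately show ?case
        by (simp add: norm_mult norm_power mult_left_mono power_mono)
    qed
  qed
  have fin: "finite {x. P x = 0}"
  proof -
    define p where "p = monom 1 (M + 1) - smult w ([:-1, 1:] ^ M)"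
    have eval: "poly p x = P x" for x by (simp add: p_def P_def poly_monom poly_power algebra_simps)
    have "poly p 1 \<noteq> 0" using M by (simp add: eval P_def power_0_left)
    then have "p \<noteq> 0" by auto
    then show ?thesis using poly_roots_finite[of p] by (simp add: eval)
  qed
  have "continuous_on (cball 0 B) P" unfolding P_def by (intro continuous_intros)
  from path_converges_to_zero[OF contW compact_cball bdd this fin limP]
  obtain r where r: "P r = 0" "(W \<longlongrightarrow> r) at_top" by blast
  have r01: "r \<noteq> 0" "r \<noteq> 1" using r(1) w M by (auto simp: P_def power_0_left)
  obtain l where l: "exp l = r" "((\<lambda>s. exp (\<gamma> s)) \<longlongrightarrow> l) at_top"
    using path_exp_converges[OF contE r01(1)] r(2) unfolding W_def by blast
  have "l \<noteq> 0" using l(1) r01(2) by auto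
  then obtain m where "(\<gamma> \<longlongrightarrow> m) at_top" using path_exp_converges[OF \<gamma>(1) _ l(2)] by blast
  then show False using \<gamma>(2) not_tendsto_and_filterlim_at_infinity[of at_top \<gamma>] by auto
qed

definition finite_critical_value :: "nat \<Rightarrow> complex" where
  "finite_critical_value M = belyi M (of_nat (M + 1))"

lemma finite_critical_value_nonzero: "M \<ge> 1 \<Longrightarrow> finite_critical_value M \<noteq> 0"
  by (auto simp: finite_critical_value_def belyi_def simp del: of_nat_Suc)

text \<open>
  Away from the poles the derivative vanishes only where \<open>exp (exp z) = M + 1\<close>.
\<close>
lemma critical_values_belyi_exp_exp_subset:
  "critical_values (belyi_exp_exp M) \<subseteq> {None, Some (finite_critical_value M)}"
proof
  fix v assume "v \<in> critical_values (belyi_exp_exp M)"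
  then obtain c where c: "critical_point (belyi_exp_exp M) c" "v = sphere_map (belyi_exp_exp M) c"
    by (auto simp: critical_values_def)
  show "v \<in> {None, Some (finite_critical_value M)}"
  proof (cases "is_pole (belyi_exp_exp M) c")
    case False
    define S where "S = {z :: complex. exp (exp z) \<noteq> 1}"
    have "exp (exp c) = of_nat (M + 1)" if W1: "exp (exp c) \<noteq> 1"
    proof (rule ccontr)
      assume "exp (exp c) \<noteq> of_nat (M + 1)"
      with W1 DERIV_imp_deriv[OF belyi_exp_exp_has_field_derivative[OF W1, of M]]
      have "deriv (belyi_exp_exp M) c \<noteq> 0" by (simp del: of_nat_Suc of_nat_add)
      then obtain r where r: "r > 0" "ball c r \<subseteq> S" "inj_on (belyi_exp_exp M) (ball c r)"
        using has_complex_derivative_locally_injective[of "belyi_exp_exp M" S c] belyi_exp_exp_holomorphic[of M]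
          open_nonpoles W1 unfolding S_def by blast
      have "inj_on (sphere_map (belyi_exp_exp M)) (ball c r)"
        using r belyi_exp_exp_not_pole[of _ M] by (auto simp: inj_on_def sphere_map_def S_def subset_iff)
      then show False using c(1) r(1) unfolding critical_point_def
        by (metis centre_in_ball open_ball)
    qed
    moreover have "belyi_exp_exp M c = 0" if "exp (exp c) = 1" "M \<ge> 1" using that by (simp add: belyi_exp_exp_def belyi_def)
    moreover have "exp (exp c) = of_nat (M + 1)" if "exp (exp c) = 1" "\<not> M \<ge> 1" using that by simp
    ultimately have "exp (exp c) = of_nat (M + 1)" using False belyi_exp_exp_pole(1)[of c M] by blast
    then show ?thesis using False c(2)
      by (simp add: sphere_map_def belyi_exp_exp_def finite_critical_value_def)
  qed (use c in \<open>simp add: sphere_map_def\<close>)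
qed

lemma finite_critical_value_critical:
  assumes "M \<ge> 1"
  shows "Some (finite_critical_value M) \<in> critical_values (belyi_exp_exp M)"
proof -
  \<comment> \<open>A point with \<open>exp (exp c) = M + 1\<close>; the inner logarithm is positive because \<open>M \<ge> 1\<close>.\<close>
  define c where "c = complex_of_real (ln (ln (real (M + 1))))"
  have pos: "ln (real (M + 1)) > 0" using assms by simp
  have "exp c = of_real (ln (real (M + 1)))" using pos unfolding c_def exp_of_real by simp
  then have "exp (exp c) = of_real (real (M + 1))" by (simp only: exp_of_real) simp
  then have W: "exp (exp c) = of_nat (M + 1)" by simp
  have W1: "exp (exp c) \<noteq> 1" unfolding W using assms by (metis Suc_eq_plus1 Suc_le_lessD diff_Suc_1 less_irrefl of_nat_eq_1_iff)
  have d0: "deriv (belyi_exp_exp M) c = 0"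
    using DERIV_imp_deriv[OF belyi_exp_exp_has_field_derivative[OF W1, of M]] by (simp add: W)
  have "critical_point (belyi_exp_exp M) c"
    unfolding critical_point_def
  proof (safe)
    fix U assume U: "open U" "c \<in> U" "inj_on (sphere_map (belyi_exp_exp M)) U"
    define S where "S = U \<inter> {z. exp (exp z) \<noteq> 1}"
    have "open S" "c \<in> S" using U open_nonpoles W1 by (auto simp: S_def)
    moreover have "inj_on (belyi_exp_exp M) S"
      using U(3) belyi_exp_exp_not_pole[of _ M] by (auto simp: inj_on_def sphere_map_def S_def)
    moreover have "belyi_exp_exp M holomorphic_on S"
      using belyi_exp_exp_holomorphic by (rule holomorphic_on_subset) (auto simp: S_def)
    ultimately have "deriv (belyi_exp_exp M) c \<noteq> 0" by (intro holomorphic_injective_imp_regular)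
    with d0 show False by simp
  qed
  moreover have "sphere_map (belyi_exp_exp M) c = Some (finite_critical_value M)"
    using belyi_exp_exp_not_pole[OF W1] by (simp add: sphere_map_def belyi_exp_exp_def finite_critical_value_def W)
  ultimately show ?thesis unfolding critical_values_def by (metis imageI mem_Collect_eq)
qed

lemma infinity_asymptotic_value: "None \<in> asymptotic_values (belyi_exp_exp M)"
  unfolding asymptotic_values_def
proof (intro CollectI exI conjI)
  show "continuous_on {0..} complex_of_real" by (intro continuous_intros)
  show "filterlim complex_of_real at_infinity at_top"
    unfolding filterlim_at_infinity_conv_norm_at_top by (simp add: filterlim_abs_real)
  show "limitin riemann_sphere (\<lambda>s. sphere_map (belyi_exp_exp M) (complex_of_real s)) None at_top"
    by (rule limitin_riemann_sphere_None[where \<gamma> = complex_of_real, OF belyi_exp_exp_at_infinity_real])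
qed

text \<open>
  On the line \<open>Im z = \<pi>\<close> the function \<open>exp (exp z)\<close> tends to 0 at the right end.
\<close>
lemma zero_asymptotic_value: 
  shows "Some 0 \<in> asymptotic_values (belyi_exp_exp M)"
  unfolding asymptotic_values_def
proof (intro CollectI exI conjI)
  let ?\<gamma> = "\<lambda>s. complex_of_real s + \<i> * pi"
  have W: "exp (exp (?\<gamma> s)) = of_real (exp (- exp s))" for s
    by (simp add: exp_add exp_of_real[symmetric] exp_minus)
  show "continuous_on {0..} ?\<gamma>" by (intro continuous_intros)
  have "filterlim complex_of_real at_infinity at_top"
    unfolding filterlim_at_infinity_conv_norm_at_top by (simp add: filterlim_abs_real)
  then show "filterlim ?\<gamma> at_infinity at_top"
    using tendsto_add_filterlim_at_infinity'[OF _ tendsto_const] by blast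
  have lim: "((\<lambda>s. exp (exp (?\<gamma> s))) \<longlongrightarrow> 0) at_top"
  proof -
    have "((\<lambda>s::real. exp (- exp s)) \<longlongrightarrow> 0) at_top"
      by (intro filterlim_compose[OF exp_at_bot] filterlim_compose[OF filterlim_uminus_at_bot_at_top] exp_at_top)
    then have "((\<lambda>s::real. complex_of_real (exp (- exp s))) \<longlongrightarrow> of_real 0) at_top" by (rule tendsto_of_real)
    then show ?thesis unfolding W by simp
  qed
  have np: "exp (exp (?\<gamma> s)) \<noteq> 1" for s unfolding W by (simp del: of_real_exp add: of_real_eq_1_iff)
  have "((\<lambda>s. belyi_exp_exp M (?\<gamma> s)) \<longlongrightarrow> 0 ^ (M + 1) / (0 - 1) ^ M) at_top"
    unfolding belyi_exp_exp_def belyi_def by (intro tendsto_intros lim) auto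
  then show "limitin riemann_sphere (\<lambda>s. sphere_map (belyi_exp_exp M) (?\<gamma> s)) (Some 0) at_top"
    unfolding limitin_riemann_sphere_Some_iff using belyi_exp_exp_not_pole[OF np] by simp
qed

lemma sing_inv_belyi_exp_exp:
  assumes M: "M \<ge> 1"
  shows "sing_inv (belyi_exp_exp M) = {None, Some 0, Some (finite_critical_value M)}"
proof
  have "w \<in> {None, Some 0}" if "w \<in> asymptotic_values (belyi_exp_exp M)" for w
  proof (cases w)
    case (Some u)
    have "\<exists>\<gamma> :: real \<Rightarrow> complex. continuous_on {0..} \<gamma> \<and> filterlim \<gamma> at_infinity at_top \<and>
        eventually (\<lambda>s. \<not> is_pole (belyi_exp_exp M) (\<gamma> s)) at_top \<and> ((\<lambda>s. belyi_exp_exp M (\<gamma> s)) \<longlongrightarrow> u) at_top"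
      using \<open>w \<in> asymptotic_values (belyi_exp_exp M)\<close>
      by (simp add: Some asymptotic_values_def limitin_riemann_sphere_Some_iff)
    then have "u = 0"
      using not_asymptotic_value_belyi_exp_exp[OF M, of u] by metis
    then show ?thesis using Some by simp
  qed auto
  then show "sing_inv (belyi_exp_exp M) \<subseteq> {None, Some 0, Some (finite_critical_value M)}"
    using critical_values_belyi_exp_exp_subset[of M] unfolding sing_inv_def by blast
  show "{None, Some 0, Some (finite_critical_value M)} \<subseteq> sing_inv (belyi_exp_exp M)"
    using infinity_asymptotic_value zero_asymptotic_value finite_critical_value_critical[OF M]
    unfolding sing_inv_def by blast
qed

lemma belyi_exp_exp_in_speiser_class_3: "M \<ge> 1 \<Longrightarrow> belyi_exp_exp M \<in> speiser_class 3"
  using belyi_exp_exp_transcendental finite_critical_value_nonzero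
  by (simp add: speiser_class_def sing_inv_belyi_exp_exp card_insert_if)

section \<open>Order of growth\<close>

lemma cos_ge_half:
  fixes y :: real
  assumes "\<bar>y\<bar> \<le> 1"
  shows "1 / 2 \<le> cos y"
proof -
  have "cos (pi / 3) \<le> cos \<bar>y\<bar>" using assms pi_gt3 by (intro cos_monotone_0_pi_le) auto
  then show ?thesis by (simp add: cos_60)
qed

lemma countable_poles: "countable {z :: complex. exp (exp z) = 1}"
proof (rule countable_subset)
  let ?g = "\<lambda>(n, m). Ln (of_int (2 * n) * pi * \<i>) + of_int (2 * m) * pi * \<i>"
  show "{z :: complex. exp (exp z) = 1} \<subseteq> range ?g"
  proof safe
    fix z :: complex assume "exp (exp z) = 1"
    then have "exp (exp z) = exp 0" by simp
    then obtain n :: int where n: "exp z = of_int (2 * n) * pi * \<i>" unfolding exp_eq by auto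
    then have "exp z = exp (Ln (of_int (2 * n) * pi * \<i>))" by (metis exp_Ln exp_not_eq_zero)
    then obtain m :: int where "z = Ln (of_int (2 * n) * pi * \<i>) + of_int (2 * m) * pi * \<i>" unfolding exp_eq by auto
    then have "z = ?g (n, m)" by simp
    then show "z \<in> range ?g" by blast
  qed
qed auto

text \<open>
  There are only countably many poles.  On a circle without poles the integrand of the proximity function is
  continuous, so its integrability is not an issue; such circles of arbitrarily large radius suffice for a limes superior.
\<close>
lemma exists_circle_without_poles:
  "\<exists>r\<ge>R. \<forall>z::complex. cmod z = r \<longrightarrow> exp (exp z) \<noteq> 1"
proof -
  have "countable (cmod ` {z. exp (exp z) = 1})" using countable_poles by (rule countable_image)
  moreover have "uncountable {R<..<R + 1}" by (simp add: uncountable_open_interval)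
  ultimately have "\<not> {R<..<R + 1} \<subseteq> cmod ` {z. exp (exp z) = 1}" using countable_subset by blast
  then obtain r where "r \<in> {R<..<R + 1}" "r \<notin> cmod ` {z. exp (exp z) = 1}" by blast
  then show ?thesis by (intro exI[of _ r]) auto
qed

text \<open>
  The origin is not a pole, so the term with \<open>ln r\<close> vanishes and the integrand is nonnegative.
\<close>
lemma nevanlinna_N_belyi_exp_exp_nonneg:
  assumes "M \<ge> 1"
  shows "0 \<le> nevanlinna_N (belyi_exp_exp M) r"
proof -
  have "\<not> is_pole (belyi_exp_exp M) 0" using assms by (simp add: is_pole_belyi_exp_exp_iff exp_eq_1)
  then have empty: "{z. is_pole (belyi_exp_exp M) z \<and> cmod z \<le> 0} = {}" by auto
  have c0: "pole_count (belyi_exp_exp M) 0 = 0" unfolding pole_count_def empty by simp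
  let ?g = "\<lambda>t. (real (pole_count (belyi_exp_exp M) t) - real (pole_count (belyi_exp_exp M) 0)) / t"
  have "0 \<le> integral {0..r} ?g"
  proof (cases "?g integrable_on {0..r}")
    case True
    then show ?thesis by (rule integral_nonneg) (simp add: c0)
  next
    case False
    then have "integral {0..r} ?g = 0" by (rule not_integrable_integral)
    then show ?thesis by simp
  qed
  then show ?thesis by (simp add: nevanlinna_N_def c0)
qed

lemma ln_norm_belyi_exp_exp_ge:
  assumes "0 \<le> Re (exp z)" "exp (exp z) \<noteq> 1"
  shows "Re (exp z) - real M * ln 2 \<le> ln (max 1 (cmod (belyi_exp_exp M z)))"
proof -
  have W: "cmod (exp (exp z)) = exp (Re (exp z))" by (rule norm_exp_eq_Re)
  then have "1 \<le> cmod (exp (exp z))" using assms by simp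
  then have "exp (Re (exp z)) / 2 ^ M \<le> cmod (belyi_exp_exp M z)"
    using norm_belyi_ge[of "exp (exp z)" M] assms W by (simp add: belyi_exp_exp_def)
  then have "exp (Re (exp z)) / 2 ^ M \<le> max 1 (cmod (belyi_exp_exp M z))" by simp
  then have "ln (exp (Re (exp z)) / 2 ^ M) \<le> ln (max 1 (cmod (belyi_exp_exp M z)))"
    by (subst ln_le_cancel_iff) auto
  then show ?thesis by (simp add: ln_div ln_realpow)
qed

text \<open>
  For \<open>0 \<le> \<theta> \<le> 1 / r\<close> the point \<open>z = r cis \<theta>\<close> satisfies \<open>Re z \<ge> r - 1\<close> and \<open>\<bar>Im z\<bar> \<le> 1\<close>, so
  \<open>Re (exp z) \<ge> exp (r - 1) / 2\<close>.
\<close>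
lemma nevanlinna_m_belyi_exp_exp_ge:
  assumes r: "1 \<le> r" and np: "\<And>z::complex. cmod z = r \<Longrightarrow> exp (exp z) \<noteq> 1"
  shows "1 / (2 * pi) * (1 / r * (exp (r - 1) / 2 - real M * ln 2)) \<le> nevanlinna_m (belyi_exp_exp M) r"
proof -
  define u where "u = (\<lambda>\<theta>. ln (max 1 (cmod (belyi_exp_exp M (of_real r * cis \<theta>)))))"
  define K where "K = exp (r - 1) / 2 - real M * ln 2"
  have npr: "exp (exp (of_real r * cis \<theta>)) \<noteq> 1" for \<theta> using r by (intro np) (simp add: norm_mult)
  have "isCont u \<theta>" for \<theta>
  proof -
    have "isCont (\<lambda>\<theta>. belyi_exp_exp M (of_real r * cis \<theta>)) \<theta>"
      by (rule isCont_o2[where f = "\<lambda>\<theta>. of_real r * cis \<theta>" and g = "belyi_exp_exp M", OF _ belyi_exp_exp_isCont[OF npr]])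
        (unfold cis_conv_exp, intro continuous_intros)
    then show ?thesis unfolding u_def by (intro continuous_intros) auto
  qed
  then have cont: "continuous_on A u" for A by (intro continuous_at_imp_continuous_on) auto
  have low: "K \<le> u \<theta>" if \<theta>: "\<theta> \<in> {0..1 / r}" for \<theta>
  proof -
    define z where "z = of_real r * cis \<theta>"
    have \<theta>': "0 \<le> \<theta>" "r * \<theta> \<le> 1" using \<theta> r by (auto simp: field_simps)
    then have \<theta>1: "\<theta> \<le> 1" using r mult_right_mono[of 1 r \<theta>] by simp
    have "\<bar>sin \<theta>\<bar> \<le> \<theta>" using abs_sin_x_le_abs_x[of \<theta>] \<theta>' by simp
    then have "r * \<bar>sin \<theta>\<bar> \<le> r * \<theta>" using r by (intro mult_left_mono) auto
    then have "r * \<bar>sin \<theta>\<bar> \<le> 1" using \<theta>' by linarith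
    then have Imz: "\<bar>Im z\<bar> \<le> 1" using r by (simp add: z_def abs_mult)
    have "0 \<le> cos \<theta>" using \<theta>' \<theta>1 pi_gt3 by (intro cos_ge_zero) auto
    then have "(cos \<theta>)\<^sup>2 \<le> cos \<theta>" by (simp add: power2_eq_square mult_left_le)
    moreover have "(sin \<theta>)\<^sup>2 \<le> \<theta>\<^sup>2" using \<open>\<bar>sin \<theta>\<bar> \<le> \<theta>\<close> by (metis abs_ge_zero power2_abs power_mono)
    ultimately have "1 - \<theta>\<^sup>2 \<le> cos \<theta>" using sin_cos_squared_add[of \<theta>] by linarith
    then have "r * (1 - \<theta>\<^sup>2) \<le> r * cos \<theta>" using r by (intro mult_left_mono) auto
    moreover have "r * \<theta>\<^sup>2 \<le> 1" using \<theta>' \<theta>1 mult_mono[of "r * \<theta>" 1 \<theta> 1] r by (simp add: power2_eq_square mult.assoc)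
    ultimately have Rez: "r - 1 \<le> Re z" by (simp add: z_def algebra_simps)
    have "exp (r - 1) * (1 / 2) \<le> exp (Re z) * cos (Im z)"
      using Rez cos_ge_half[OF Imz] by (intro mult_mono) auto
    then have "exp (r - 1) / 2 \<le> Re (exp z)" by (simp add: Re_exp)
    moreover from this have "0 \<le> Re (exp z)" by (smt (verit) exp_gt_zero half_gt_zero)
    ultimately show ?thesis
      using ln_norm_belyi_exp_exp_ge[of z M] npr[of \<theta>] unfolding K_def u_def z_def by linarith
  qed
  have "1 / r * K = integral {0..1 / r} (\<lambda>_. K)" using r by simp
  also have "\<dots> \<le> integral {0..1 / r} u"
    using low by (intro integral_le integrable_continuous_real cont continuous_intros) auto
  also have "\<dots> \<le> integral {0..2 * pi} u"
  proof (rule integral_subset_le)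
    have "1 / r \<le> 1" using r by simp
    then have "1 / r \<le> 2 * pi" using pi_gt3 by linarith
    then show "{0..1 / r} \<subseteq> {0..2 * pi}" by auto
  qed (auto simp: u_def intro!: integrable_continuous_real cont[unfolded u_def])
  finally show ?thesis unfolding nevanlinna_m_def u_def K_def by (intro mult_left_mono) auto
qed

lemma meromorphic_order_belyi_exp_exp:
  assumes M: "M \<ge> 1"
  shows "meromorphic_order (belyi_exp_exp M) = \<infinity>"
proof (rule ccontr)
  assume "meromorphic_order (belyi_exp_exp M) \<noteq> \<infinity>"
  then have "meromorphic_order (belyi_exp_exp M) < \<infinity>" by simp
  then obtain y where y: "meromorphic_order (belyi_exp_exp M) < ereal y" using less_PInf_Ex_of_nat[of "meromorphic_order (belyi_exp_exp M)"]
    by (metis ereal_dense2)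
  define c where "c = real M * ln 2"
  define h where "h = (\<lambda>r::real. 1 / (2 * pi) * (1 / r * (exp (r - 1) / 2 - c)))"
  have "eventually (\<lambda>r. ereal (ln (nevanlinna_T (belyi_exp_exp M) r) / ln r) < ereal y) at_top"
    using y unfolding meromorphic_order_def by (rule Limsup_lessD)
  moreover have "eventually (\<lambda>r. h r > 0) at_top" unfolding h_def by real_asymp
  moreover have "eventually (\<lambda>r. ln (h r) / ln r \<ge> y) at_top"
  proof -
    have "filterlim (\<lambda>r. ln (h r) / ln r) at_top at_top" unfolding h_def by real_asymp
    then show ?thesis unfolding filterlim_at_top by blast
  qed
  moreover have "eventually (\<lambda>r::real. r > 1) at_top" by (rule eventually_gt_at_top)
  ultimately have "eventually (\<lambda>r. ln (nevanlinna_T (belyi_exp_exp M) r) / ln r < y \<and> h r > 0 \<and> ln (h r) / ln r \<ge> y \<and> r > 1) at_top"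
    by eventually_elim auto
  then obtain R where R: "\<And>r. r \<ge> R \<Longrightarrow> ln (nevanlinna_T (belyi_exp_exp M) r) / ln r < y \<and> h r > 0 \<and> ln (h r) / ln r \<ge> y \<and> r > 1"
    unfolding eventually_at_top_linorder by blast
  obtain r where r: "r \<ge> R" "\<And>z::complex. cmod z = r \<Longrightarrow> exp (exp z) \<noteq> 1" using exists_circle_without_poles by blast
  have "h r \<le> nevanlinna_T (belyi_exp_exp M) r"
    using nevanlinna_m_belyi_exp_exp_ge[of r M] nevanlinna_N_belyi_exp_exp_nonneg[OF M, of r] R[OF r(1)] r(2)
    unfolding nevanlinna_T_def h_def c_def by fastforce
  then have "ln (h r) / ln r \<le> ln (nevanlinna_T (belyi_exp_exp M) r) / ln r"
    using R[OF r(1)] by (intro divide_right_mono) auto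
  then show False using R[OF r(1)] by linarith
qed

section \<open>Mapping properties far to the right\<close>

text \<open>
  The preimage is \<open>p + Ln (w / exp p)\<close>, and \<open>\<bar>Ln (1 + u)\<bar> \<le> 2 \<bar>u\<bar>\<close> for small \<open>u\<close>.
\<close>
lemma exp_covers_ball:
  fixes p w :: complex
  assumes "\<rho> < 1" "cmod (w - exp p) \<le> cmod (exp p) * \<rho> / 2"
  obtains z where "z \<in> cball p \<rho>" "exp z = w"
proof -
  define u where "u = (w - exp p) / exp p"
  have "cmod u = cmod (w - exp p) / cmod (exp p)" by (simp add: u_def norm_divide)
  also have "\<dots> \<le> \<rho> / 2"
    using assms(2) norm_exp_eq_Re[of p] by (simp add: field_simps)
  finally have u: "cmod u \<le> \<rho> / 2" .
  then have u1: "cmod u < 1 / 2" using assms(1) by simp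
  have "1 + u \<noteq> 0"
  proof
    assume "1 + u = 0"
    then have "u = - 1" by (simp add: add_eq_0_iff)
    with u1 show False by simp
  qed
  then have "exp (p + Ln (1 + u)) = exp p * (1 + u)" by (simp add: exp_add)
  also have "\<dots> = w" by (simp add: u_def field_simps)
  finally have "exp (p + Ln (1 + u)) = w" .
  moreover have "p + Ln (1 + u) \<in> cball p \<rho>"
    using norm_Ln_le[OF u1] u by (simp add: dist_norm)
  ultimately show ?thesis using that by blast
qed

text \<open>
  The equation \<open>h(W) = w\<close> reads \<open>W = w (1 - 1/W)^M\<close>.  For large \<open>w\<close> the right side maps the disc of radius \<open>\<bar>w\<bar> / 2\<close>
  about \<open>w\<close> into itself, so Brouwer's theorem provides a solution there.
\<close>
lemma belyi_surjective_near_infinity: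
  obtains R where "R > 0" "\<And>w. R \<le> cmod w \<Longrightarrow> \<exists>W. belyi M W = w \<and> cmod w / 2 \<le> cmod W \<and> cmod W \<le> 3 / 2 * cmod w"
proof -
  have "isCont (\<lambda>x::complex. (1 - x) ^ M) 0" by (intro continuous_intros)
  then have "((\<lambda>x::complex. (1 - x) ^ M) \<longlongrightarrow> 1) (at 0)" unfolding isCont_def by simp
  then have "eventually (\<lambda>x::complex. dist ((1 - x) ^ M) 1 < 1 / 2) (at 0)" by (rule tendstoD) simp
  then obtain d where d: "d > 0" "\<And>x::complex. x \<noteq> 0 \<Longrightarrow> cmod x < d \<Longrightarrow> cmod ((1 - x) ^ M - 1) < 1 / 2"
    unfolding eventually_at by (auto simp: dist_norm)
  define R where "R = max 3 (3 / d)"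
  show ?thesis
  proof (rule that[of R])
    show "R > 0" by (simp add: R_def)
    fix w :: complex assume w: "R \<le> cmod w"
    then have w3: "cmod w \<ge> 3" "cmod w \<ge> 3 / d" by (auto simp: R_def)
    define \<phi> where "\<phi> = (\<lambda>W. w * (1 - 1 / W) ^ M)"
    have ball: "cmod w / 2 \<le> cmod W \<and> cmod W \<le> 3 / 2 * cmod w" if "W \<in> cball w (cmod w / 2)" for W
      using that norm_triangle_ineq2[of w W] norm_triangle_ineq2[of W w] by (simp add: dist_norm norm_minus_commute)
    have "continuous_on (cball w (cmod w / 2)) \<phi>"
      unfolding \<phi>_def using ball w3 by (intro continuous_intros) force
    moreover have "\<phi> \<in> cball w (cmod w / 2) \<rightarrow> cball w (cmod w / 2)"
    proof
      fix W assume W: "W \<in> cball w (cmod w / 2)"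
      have W0: "cmod W \<ge> 3 / 2" "W \<noteq> 0" using ball[OF W] w3 by auto
      have "3 \<le> cmod w * d" using w3(2) d(1) by (simp add: field_simps)
      moreover have "cmod w * d \<le> 2 * cmod W * d" using ball[OF W] d(1) by (intro mult_right_mono) auto
      ultimately have "3 / 2 \<le> cmod W * d" by linarith
      then have "cmod (1 / W) < d" using W0 by (simp add: norm_divide field_simps)
      then have "cmod ((1 - 1 / W) ^ M - 1) \<le> 1 / 2" using d(2)[of "1 / W"] W0 by simp
      then have "cmod w * cmod ((1 - 1 / W) ^ M - 1) \<le> cmod w * (1 / 2)" by (intro mult_left_mono) auto
      moreover have "\<phi> W - w = w * ((1 - 1 / W) ^ M - 1)" by (simp add: \<phi>_def algebra_simps)
      ultimately have "cmod (\<phi> W - w) \<le> cmod w / 2" by (simp add: norm_mult)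
      then show "\<phi> W \<in> cball w (cmod w / 2)" by (simp add: dist_norm norm_minus_commute)
    qed
    ultimately obtain W where W: "W \<in> cball w (cmod w / 2)" "\<phi> W = W"
      using brouwer_ball[of "cmod w / 2" w \<phi>] w3 by force
    have W0: "W \<noteq> 0" "W \<noteq> 1" using ball[OF W(1)] w3 by auto
    have "1 - 1 / W = (W - 1) / W" using W0 by (simp add: field_simps)
    then have "W = w * (W - 1) ^ M / W ^ M" using W(2) by (simp add: \<phi>_def power_divide)
    then have "W * W ^ M = w * (W - 1) ^ M" using W0 by (simp add: eq_divide_eq)
    then have "belyi M W = w" using W0 by (simp add: belyi_def field_simps)
    then show "\<exists>W. belyi M W = w \<and> cmod w / 2 \<le> cmod W \<and> cmod W \<le> 3 / 2 * cmod w"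
      using ball[OF W(1)] by blast
  qed
qed

text \<open>
  Given \<open>w\<close>, choose \<open>W\<close> with \<open>h(W) = w\<close>; then \<open>V = W / exp (exp p)\<close> has modulus between \<open>1/2\<close> and 6, and
  \<open>exp p + Ln V\<close> is a logarithm of \<open>W\<close> at distance at most 10 from \<open>exp p\<close>.
\<close>
lemma belyi_exp_exp_covers_annulus:
  obtains R where "R > 0"
    "\<And>p \<rho> w. R \<le> exp (Re (exp p)) \<Longrightarrow> \<rho> < 1 \<Longrightarrow> 20 \<le> cmod (exp p) * \<rho> \<Longrightarrow>
       exp (Re (exp p)) \<le> cmod w \<Longrightarrow> cmod w \<le> 4 * exp (Re (exp p)) \<Longrightarrow>
       \<exists>z\<in>cball p \<rho>. belyi_exp_exp M z = w"
proof -
  obtain R where R: "R > 0" "\<And>w. R \<le> cmod w \<Longrightarrow>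
      \<exists>W. belyi M W = w \<and> cmod w / 2 \<le> cmod W \<and> cmod W \<le> 3 / 2 * cmod w"
    using belyi_surjective_near_infinity by blast
  show ?thesis
  proof (rule that[OF R(1)])
    fix p w :: complex and \<rho> :: real
    define r where "r = exp (Re (exp p))"
    assume r: "R \<le> exp (Re (exp p))" and \<rho>: "\<rho> < 1" "20 \<le> cmod (exp p) * \<rho>"
      and w: "exp (Re (exp p)) \<le> cmod w" "cmod w \<le> 4 * exp (Re (exp p))"
    obtain W where W: "belyi M W = w" "cmod w / 2 \<le> cmod W" "cmod W \<le> 3 / 2 * cmod w"
      using R(2)[of w] r w by auto
    have rpos: "r > 0" by (simp add: r_def)
    define V where "V = W / exp (exp p)"
    have V: "cmod V = cmod W / r" by (simp add: V_def norm_divide r_def norm_exp_eq_Re)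
    have V12: "1 / 2 \<le> cmod V" "cmod V \<le> 6"
      unfolding V using W w rpos by (auto simp: r_def[symmetric] field_simps)
    then have V0: "V \<noteq> 0" by auto
    have "cmod (Ln V) \<le> \<bar>Re (Ln V)\<bar> + \<bar>Im (Ln V)\<bar>" by (rule cmod_le)
    moreover have "\<bar>Im (Ln V)\<bar> \<le> pi" using mpi_less_Im_Ln[OF V0] Im_Ln_le_pi[OF V0] by simp
    moreover have "\<bar>Re (Ln V)\<bar> \<le> 5"
    proof -
      have "ln (cmod V) \<le> cmod V - 1" using V0 by (intro ln_le_minus_one) auto
      moreover have "ln (1 / 2) \<le> ln (cmod V)" using V12 V0 by (subst ln_le_cancel_iff) auto
      moreover have "ln 2 \<le> (2 :: real) - 1" by (intro ln_le_minus_one) auto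
      ultimately show ?thesis using V12 V0 by (simp add: ln_div)
    qed
    ultimately have "cmod (Ln V) \<le> 10" using pi_less_4 by linarith
    also have "10 \<le> cmod (exp p) * \<rho> / 2" using \<rho> by simp
    finally have "cmod ((exp p + Ln V) - exp p) \<le> cmod (exp p) * \<rho> / 2" by simp
    then obtain z where z: "z \<in> cball p \<rho>" "exp z = exp p + Ln V"
      using exp_covers_ball[OF \<rho>(1)] by blast
    have "exp (exp z) = W" using V0 by (simp add: z exp_add V_def)
    then have "belyi_exp_exp M z = w" by (simp add: belyi_exp_exp_def W)
    then show "\<exists>z\<in>cball p \<rho>. belyi_exp_exp M z = w" using z(1) by blast
  qed
qed

lemma belyi_derivative_bound:
  assumes "2 \<le> cmod w"
  shows "cmod (w ^ M * (w - of_nat (M + 1)) / (w - 1) ^ (M + 1)) \<le> 2 ^ M * real (M + 1)"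
proof -
  have 1: "1 \<le> cmod (w - 1)" "cmod w \<le> 2 * cmod (w - 1)"
    using norm_triangle_ineq2[of w 1] assms by auto
  have eq: "w - of_nat (M + 1) = (w - 1) - of_nat M" by simp
  have "cmod (w - of_nat (M + 1)) \<le> cmod (w - 1) + real M"
    unfolding eq using norm_triangle_ineq4[of "w - 1" "of_nat M"] by simp
  also have "\<dots> \<le> real (M + 1) * cmod (w - 1)"
    using 1 mult_left_mono[of 1 "cmod (w - 1)" "real M"] by (simp add: algebra_simps)
  finally have 2: "cmod (w - of_nat (M + 1)) \<le> real (M + 1) * cmod (w - 1)" .
  have "cmod w ^ M * cmod (w - of_nat (M + 1)) \<le> (2 * cmod (w - 1)) ^ M * (real (M + 1) * cmod (w - 1))"
    using 1 2 by (intro mult_mono power_mono) auto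
  also have "\<dots> = 2 ^ M * real (M + 1) * cmod (w - 1) ^ (M + 1)" by (simp add: power_mult_distrib)
  finally have "cmod w ^ M * cmod (w - of_nat (M + 1)) \<le> 2 ^ M * real (M + 1) * cmod (w - 1) ^ (M + 1)" .
  moreover have "0 < cmod (w - 1) ^ (M + 1)" using 1 by (intro zero_less_power) linarith
  ultimately show ?thesis unfolding norm_divide norm_mult norm_power by (subst pos_divide_le_eq)
qed

text \<open>
  Horizontal strips about the lines \<open>Im z \<in> 2 \<pi> \<int>\<close>, cut off on the left.  There \<open>Re (exp z)\<close> is comparable to
  \<open>\<bar>exp z\<bar>\<close>, and \<open>exp (exp z)\<close> is huge.
\<close>
definition strip_region :: "real \<Rightarrow> complex set" where
  "strip_region X = {z. X \<le> Re z \<and> 1 / 2 \<le> cos (Im z)}"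

lemma strip_region_exp:
  assumes "z \<in> strip_region X"
  shows "exp X / 2 \<le> Re (exp z)"
proof -
  have "exp X * (1 / 2) \<le> exp (Re z) * cos (Im z)"
    using assms by (intro mult_mono) (auto simp: strip_region_def)
  then show ?thesis by (simp add: Re_exp)
qed

lemma strip_region_norm_exp_exp:
  assumes "z \<in> strip_region X" "1 \<le> X"
  shows "2 \<le> cmod (exp (exp z))"
proof -
  have "2 \<le> exp X" using exp_ge_add_one_self[of X] assms by linarith
  then have "1 \<le> Re (exp z)" using strip_region_exp[OF assms(1)] by linarith
  then show ?thesis using exp_ge_add_one_self[of "Re (exp z)"] norm_exp_eq_Re[of "exp z"] by linarith
qed

lemma strip_region_exp_exp_neq_1:
  assumes "z \<in> strip_region X" "1 \<le> X"
  shows "exp (exp z) \<noteq> 1"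
proof
  assume e: "exp (exp z) = 1"
  show False using strip_region_norm_exp_exp[OF assms] unfolding e by simp
qed

text \<open>
  On a disc of radius \<open>20 exp (-a)\<close> the function \<open>exp\<close> varies by at most \<open>3 exp a * 20 exp (-a) = 60\<close>, so
  \<open>exp \<circ> exp\<close> varies by a bounded factor; this gives the size of all factors of the derivative.
\<close>
lemma belyi_exp_exp_lipschitz:
  fixes p :: complex
  defines "r \<equiv> exp (Re (exp p))"
  assumes a: "1 \<le> a" and \<rho>: "0 \<le> \<rho>" "\<rho> \<le> 20 * exp (- a)"
    and sub: "cball p \<rho> \<subseteq> strip_region a" and up: "\<And>z. z \<in> cball p \<rho> \<Longrightarrow> Re z \<le> a + 1"
    and xy: "x \<in> cball p \<rho>" "y \<in> cball p \<rho>"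
  shows "dist (belyi_exp_exp M x) (belyi_exp_exp M y) \<le> 2 ^ M * real (M + 1) * exp 60 * 3 * r * exp a * dist x y"
proof -
  have e3: "exp (1::real) \<le> 3" by (rule exp_le)
  have nexp: "cmod (exp z) \<le> 3 * exp a" if "z \<in> cball p \<rho>" for z
  proof -
    have "cmod (exp z) \<le> exp (a + 1)" using up[OF that] by (simp add: norm_exp_eq_Re)
    also have "\<dots> = exp 1 * exp a" by (simp add: exp_add)
    also have "\<dots> \<le> 3 * exp a" using e3 by (intro mult_right_mono) auto
    finally show ?thesis .
  qed
  have W: "cmod (exp (exp z)) \<le> exp 60 * r" if z: "z \<in> cball p \<rho>" for z
  proof -
    have "cmod (exp z - exp p) \<le> 3 * exp a * cmod (z - p)"
    proof (rule field_differentiable_bound[of "cball p \<rho>"])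
      show "(exp has_field_derivative exp w) (at w within cball p \<rho>)" for w :: complex
        by (rule DERIV_subset[OF DERIV_exp]) auto
    qed (use nexp z \<rho> in auto)
    also have "\<dots> \<le> 3 * exp a * (20 * exp (- a))"
      using z \<rho> by (intro mult_left_mono) (auto simp: dist_norm norm_minus_commute)
    also have "\<dots> = 60" by (simp add: exp_minus)
    finally have "Re (exp z) \<le> Re (exp p) + 60" using complex_Re_le_cmod[of "exp z - exp p"] by simp
    then have "exp (Re (exp z)) \<le> exp (Re (exp p) + 60)" by simp
    then show ?thesis by (simp add: norm_exp_eq_Re r_def exp_add mult.commute)
  qed
  define f' where "f' = (\<lambda>z. exp (exp z) ^ M * (exp (exp z) - of_nat (M + 1)) / (exp (exp z) - 1) ^ (M + 1) *
           (exp (exp z) * exp z) :: complex)"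
  have "cmod (belyi_exp_exp M x - belyi_exp_exp M y) \<le> (2 ^ M * real (M + 1) * exp 60 * 3 * r * exp a) * cmod (x - y)"
  proof (rule field_differentiable_bound[of "cball p \<rho>" _ f'])
    fix z assume z: "z \<in> cball p \<rho>"
    have zs: "z \<in> strip_region a" using sub z by blast
    note W2 = strip_region_norm_exp_exp[OF zs a]
    show "(belyi_exp_exp M has_field_derivative f' z) (at z within cball p \<rho>)"
      unfolding f'_def
      by (rule has_field_derivative_at_within[OF belyi_exp_exp_has_field_derivative[OF strip_region_exp_exp_neq_1[OF zs a]]])
    have "cmod (f' z) \<le> (2 ^ M * real (M + 1)) * ((exp 60 * r) * (3 * exp a))"
      unfolding f'_def norm_mult[of "_ / _"] norm_mult[of "exp (exp z)" "exp z"]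
      using belyi_derivative_bound[OF W2, of M] W[OF z] nexp[OF z]
      by (intro mult_mono) (auto simp: r_def)
    then show "cmod (f' z) \<le> 2 ^ M * real (M + 1) * exp 60 * 3 * r * exp a" by (simp add: mult_ac)
  qed (use xy in auto)
  then show ?thesis by (simp add: dist_norm)
qed

text \<open>
  Squares of side 1 centred on the lines \<open>Im z = 2 \<pi> m\<close>, inside the strips.
\<close>
definition unit_square :: "real \<Rightarrow> nat \<Rightarrow> complex set" where
  "unit_square a m = cbox (Complex a (2 * pi * real m - 1 / 2)) (Complex a (2 * pi * real m - 1 / 2) + Complex 1 1)"

lemma in_unit_square_iff:
  "z \<in> unit_square a m \<longleftrightarrow> a \<le> Re z \<and> Re z \<le> a + 1 \<and> \<bar>Im z - 2 * pi * real m\<bar> \<le> 1 / 2"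
  unfolding abs_diff_le_iff by (auto simp: unit_square_def in_cbox_complex_iff)

lemma unit_square_subset_strip_region: "unit_square a m \<subseteq> strip_region a"
proof
  fix z assume z: "z \<in> unit_square a m"
  have "cos (Im z) = cos ((Im z - 2 * pi * real m) + 2 * real m * pi)" by (simp add: mult_ac)
  also have "\<dots> = cos (Im z - 2 * pi * real m)" by (simp only: cos_add cos_2npi sin_2npi)
  also have "\<dots> \<ge> 1 / 2" using z by (intro cos_ge_half) (auto simp: in_unit_square_iff)
  finally show "z \<in> strip_region a" using z by (simp add: strip_region_def in_unit_square_iff)
qed

lemma eventually_powr_large:
  assumes "0 < k" "0 < (d::real)"
  obtains B where "B > 0" "\<And>x. B \<le> x \<Longrightarrow> 1 / 16 \<le> k * x powr d"
proof -
  define B where "B = (1 / (16 * k)) powr (1 / d)"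
  show ?thesis
  proof (rule that[of B])
    show "B > 0" using assms by (simp add: B_def)
    fix x assume "B \<le> x"
    then have "B powr d \<le> x powr d" using assms by (intro powr_mono2) (auto simp: B_def)
    moreover have "B powr d = 1 / (16 * k)" using assms by (simp add: B_def powr_powr)
    ultimately show "1 / 16 \<le> k * x powr d" using assms by (simp add: field_simps)
  qed
qed

text \<open>
  Below \<open>f\<close>: the part of the annulus to the right contains a square grid of \<open>N^2\<close> unit squares with spacing \<open>2 \<pi>\<close>,
  where \<open>N\<close> is about \<open>r / 20\<close>, to which the grid estimate applies.
\<close>
lemma content_ge_large_scale:
  assumes s: "0 < s" "s < 2" and r: "20 \<le> r"
    and N: "N = nat \<lfloor>r / 20\<rfloor>" and c: "1 / 16 \<le> (1 / 512) / (2 * pi) powr s * real N powr (2 - s)"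
    and E: "\<And>b m. r \<le> b \<Longrightarrow> content_ge s (E \<inter> unit_square b m) (1 / 512)"
  shows "content_ge s {w\<in>E. r \<le> Re w \<and> r \<le> cmod w \<and> cmod w \<le> 4 * r} ((r / 10) powr s / 32)"
proof -
  define sq where "sq = (\<lambda>(i::nat, j::nat). E \<inter> unit_square (r + 2 * pi * real i) (Suc j))"
  have N1: "1 \<le> N" using r by (simp add: N le_nat_iff)
  have "real N = of_int \<lfloor>r / 20\<rfloor>" using r by (simp add: N)
  then have Nr: "real N \<le> r / 20" "r / 20 < real N + 1" using floor_correct[of "r / 20"] by auto
  have "content_ge s (\<Union>i<N. \<Union>j<N. sq (i, j)) ((real N * (2 * pi)) powr s / 32)"
  proof (rule content_ge_grid[where p = "Complex (r + 1 / 2) (2 * pi)" and c = "(1 / 512) / (2 * pi) powr s"])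
    fix i j :: nat
    show "sq (i, j) \<subseteq> cball (Complex (r + 1 / 2) (2 * pi) + complex_of_real (2 * pi) * Complex (real i) (real j)) (2 * pi / 4)"
    proof
      fix z assume "z \<in> sq (i, j)"
      then have z: "z \<in> unit_square (r + 2 * pi * real i) (Suc j)" by (simp add: sq_def)
      let ?q = "Complex (r + 1 / 2) (2 * pi) + complex_of_real (2 * pi) * Complex (real i) (real j)"
      have "Re (z - ?q) = Re z - (r + 2 * pi * real i) - 1 / 2" "Im (z - ?q) = Im z - 2 * pi * real (Suc j)"
        by (simp_all add: algebra_simps)
      then have "\<bar>Re (z - ?q)\<bar> \<le> 1 / 2" "\<bar>Im (z - ?q)\<bar> \<le> 1 / 2"
        using z unfolding in_unit_square_iff by linarith+
      then have "cmod (z - ?q) \<le> 1" using cmod_le[of "z - ?q"] by linarith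
      then show "z \<in> cball ?q (2 * pi / 4)" using pi_gt3 by (simp add: dist_norm norm_minus_commute)
    qed
    show "content_ge s (sq (i, j)) (1 / 512 / (2 * pi) powr s * (2 * pi) powr s)"
      using E[of "r + 2 * pi * real i" "Suc j"] by (simp add: sq_def)
  qed (use s N1 c in auto)
  then show ?thesis
  proof (rule content_ge_mono)
    have "r / 10 \<le> real N * 4" using Nr N1 by linarith
    also have "\<dots> \<le> real N * (2 * pi)" using pi_gt3 by (intro mult_left_mono) auto
    finally have "(r / 10) powr s \<le> (real N * (2 * pi)) powr s" using r s by (intro powr_mono2) auto
    then show "(r / 10) powr s / 32 \<le> (real N * (2 * pi)) powr s / 32" by simp
    show "(\<Union>i<N. \<Union>j<N. sq (i, j)) \<subseteq> {w\<in>E. r \<le> Re w \<and> r \<le> cmod w \<and> cmod w \<le> 4 * r}"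
    proof safe
      fix z i j assume ij: "i < N" "j < N" and "z \<in> sq (i, j)"
      then have zE: "z \<in> E" and z: "z \<in> unit_square (r + 2 * pi * real i) (Suc j)" by (auto simp: sq_def)
      show "z \<in> E" by (rule zE)
      have "0 \<le> 2 * pi * real i" by simp
      then show Re: "r \<le> Re z" using z unfolding in_unit_square_iff by linarith
      then show "r \<le> cmod z" using complex_Re_le_cmod[of z] by linarith
      have "2 * pi * real i \<le> 2 * pi * real N" "2 * pi * real (Suc j) \<le> 2 * pi * real N"
        using ij by (auto intro!: mult_left_mono simp del: of_nat_Suc)
      moreover have "2 * pi * real N \<le> 2 * 4 * (r / 20)"
        using Nr pi_less_4 by (intro mult_mono) auto
      moreover have "0 \<le> 2 * pi * real (Suc j)" by (simp del: of_nat_Suc)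
      ultimately have "\<bar>Re z\<bar> \<le> r + 2 * 4 * (r / 20) + 1" "\<bar>Im z\<bar> \<le> 2 * 4 * (r / 20) + 1 / 2"
        using z Re r unfolding in_unit_square_iff by linarith+
      then show "cmod z \<le> 4 * r" using cmod_le[of z] r by linarith
    qed
  qed
qed

definition lipschitz_const :: "nat \<Rightarrow> real" where
  "lipschitz_const M = 2 ^ M * real (M + 1) * exp 60 * 3"

lemma lipschitz_const_pos: "0 < lipschitz_const M"
  by (simp add: lipschitz_const_def)

text \<open>
  Above \<open>f\<close>: the estimate for the annulus is pulled back to the disc that covers it.  The factor \<open>r\<close> cancels, and what
  remains is comparable to the radius of the disc raised to the power \<open>s\<close>.
\<close>
lemma content_ge_small_scale:
  fixes p :: complex
  defines "r \<equiv> exp (Re (exp p))"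
  assumes s: "0 < s" and a: "1 \<le> a" and \<rho>: "0 \<le> \<rho>" "\<rho> \<le> 20 * exp (- a)"
    and sub: "cball p \<rho> \<subseteq> strip_region a" and up: "\<And>z. z \<in> cball p \<rho> \<Longrightarrow> Re z \<le> a + 1"
    and cover: "\<And>w. r \<le> cmod w \<Longrightarrow> cmod w \<le> 4 * r \<Longrightarrow> \<exists>z\<in>cball p \<rho>. belyi_exp_exp M z = w"
    and E: "content_ge s {w\<in>E. r \<le> Re w \<and> r \<le> cmod w \<and> cmod w \<le> 4 * r} ((r / 10) powr s / 32)"
  shows "content_ge s {z\<in>cball p \<rho>. belyi_exp_exp M z \<in> E \<and> r \<le> Re (belyi_exp_exp M z)}
           ((1 / (10 * lipschitz_const M * exp a)) powr s / 32)"
proof -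
  define L where "L = lipschitz_const M * r * exp a"
  have rpos: "r > 0" by (simp add: r_def)
  have L: "L > 0" using lipschitz_const_pos[of M] rpos by (simp add: L_def)
  have content: "content_ge s {z\<in>cball p \<rho>. belyi_exp_exp M z \<in> E \<and> r \<le> Re (belyi_exp_exp M z)} ((r / 10) powr s / 32 / L powr s)"
  proof (rule content_ge_lipschitz[OF E s L, where f = "belyi_exp_exp M"])
    show "{w\<in>E. r \<le> Re w \<and> r \<le> cmod w \<and> cmod w \<le> 4 * r}
       \<subseteq> belyi_exp_exp M ` {z\<in>cball p \<rho>. belyi_exp_exp M z \<in> E \<and> r \<le> Re (belyi_exp_exp M z)}"
    proof
      fix w assume w: "w \<in> {w\<in>E. r \<le> Re w \<and> r \<le> cmod w \<and> cmod w \<le> 4 * r}"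
      then obtain z where "z \<in> cball p \<rho>" "belyi_exp_exp M z = w" using cover by blast
      with w show "w \<in> belyi_exp_exp M ` {z\<in>cball p \<rho>. belyi_exp_exp M z \<in> E \<and> r \<le> Re (belyi_exp_exp M z)}"
        by (intro image_eqI[of _ _ z]) auto
    qed
    show "dist (belyi_exp_exp M x) (belyi_exp_exp M y) \<le> L * dist x y"
      if "x \<in> {z\<in>cball p \<rho>. belyi_exp_exp M z \<in> E \<and> r \<le> Re (belyi_exp_exp M z)}"
         "y \<in> {z\<in>cball p \<rho>. belyi_exp_exp M z \<in> E \<and> r \<le> Re (belyi_exp_exp M z)}" for x y
      using belyi_exp_exp_lipschitz[OF a \<rho> sub up, of x y M] that unfolding L_def lipschitz_const_def r_def by blast
  qed
  have "(r / 10) powr s / 32 / L powr s = ((r / 10) / L) powr s / 32"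
    using rpos L by (simp add: powr_divide powr_mult)
  also have "(r / 10) / L = 1 / (10 * lipschitz_const M * exp a)"
    using rpos by (simp add: L_def)
  finally show ?thesis using content by (simp only:)
qed

text \<open>
  The inductive step.  The unit square contains a grid of discs of radius \<open>\<sigma> / 4 = 20 exp (-a)\<close> with spacing \<open>\<sigma>\<close>.
  Each disc inherits from the grid of unit squares below it a bound of the form \<open>const * \<sigma>^s\<close>, and a second
  application of the grid estimate, to the discs, restores the constant \<open>1/512\<close>.
\<close>
lemma content_ge_unit_square_step:
  fixes s :: real and M :: nat
  assumes s: "0 < s" "s < 2"
  obtains X where "1 \<le> X"
    "\<And>E a m. X \<le> a \<Longrightarrow> (\<And>b m. X \<le> b \<Longrightarrow> content_ge s (E \<inter> unit_square b m) (1 / 512)) \<Longrightarrow>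
       content_ge s {z\<in>unit_square a m. belyi_exp_exp M z \<in> E \<and> Re z + 1 \<le> Re (belyi_exp_exp M z)} (1 / 512)"
proof -
  define C where "C = lipschitz_const M"
  have C: "C > 0" by (simp add: C_def lipschitz_const_pos)
  obtain R where R: "R > 0"
    "\<And>p \<rho> w. R \<le> exp (Re (exp p)) \<Longrightarrow> \<rho> < 1 \<Longrightarrow> 20 \<le> cmod (exp p) * \<rho> \<Longrightarrow>
       exp (Re (exp p)) \<le> cmod w \<Longrightarrow> cmod w \<le> 4 * exp (Re (exp p)) \<Longrightarrow>
       \<exists>z\<in>cball p \<rho>. belyi_exp_exp M z = w"
    using belyi_exp_exp_covers_annulus[of M] by blast
  obtain B1 where B1: "B1 > 0" "\<And>x. B1 \<le> x \<Longrightarrow> 1 / 16 \<le> (1 / (800 * C)) powr s / 32 * x powr (2 - s)"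
    using eventually_powr_large[of "(1 / (800 * C)) powr s / 32" "2 - s"] s C by auto
  obtain B2 where B2: "B2 > 0" "\<And>x. B2 \<le> x \<Longrightarrow> 1 / 16 \<le> (1 / 512) / (2 * pi) powr s * x powr (2 - s)"
    using eventually_powr_large[of "(1 / 512) / (2 * pi) powr s" "2 - s"] s by auto
  \<comment> \<open>Here 320 is \<open>4 * 80\<close>: it makes the spacing \<open>\<sigma> = 80 exp (-a)\<close> at most \<open>1/4\<close> and the number of discs in a row at least
    \<open>exp a / 320\<close>.  By the last condition \<open>r \<ge> exp (exp a / 2)\<close> exceeds \<open>R\<close>, 20, \<open>a\<close> and 40 times \<open>B2\<close>; and as \<open>R > 0\<close>, the
    summand 20 also leaves room for a step of length 1 to the right.\<close>
  have "eventually (\<lambda>a::real. 320 \<le> exp a \<and> 1 \<le> a \<and> 320 * B1 \<le> exp a \<and> R + 20 + 40 * B2 + a \<le> exp (exp a / 2)) at_top"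
    by (intro eventually_conj; real_asymp)
  then obtain X where X: "\<And>a. X \<le> a \<Longrightarrow> 320 \<le> exp a \<and> 1 \<le> a \<and> 320 * B1 \<le> exp a \<and> R + 20 + 40 * B2 + a \<le> exp (exp a / 2)"
    unfolding eventually_at_top_linorder by blast
  show ?thesis
  proof (rule that[of X])
    show "1 \<le> X" using X[of X] by auto
    fix E a m
    assume aX: "X \<le> a" and E: "\<And>b m. X \<le> b \<Longrightarrow> content_ge s (E \<inter> unit_square b m) (1 / 512)"
    have a: "320 \<le> exp a" "1 \<le> a" "320 * B1 \<le> exp a" "R + 20 + 40 * B2 + a \<le> exp (exp a / 2)"
      using X[OF aX] by auto
    define \<sigma> where "\<sigma> = 80 * exp (- a)"
    have \<sigma>: "0 < \<sigma>" "\<sigma> \<le> 1 / 4" using a(1) by (auto simp: \<sigma>_def exp_minus field_simps)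
    have \<sigma>e: "\<sigma> * exp a = 80" by (simp add: \<sigma>_def exp_minus)
    define N where "N = nat \<lfloor>1 / (2 * \<sigma>)\<rfloor>"
    have "1 / (2 * \<sigma>) \<ge> 2" using \<sigma> by (simp add: field_simps)
    have "real N = of_int \<lfloor>1 / (2 * \<sigma>)\<rfloor>" using \<sigma> by (simp add: N_def)
    then have "real N \<le> 1 / (2 * \<sigma>)" "1 / (2 * \<sigma>) < real N + 1"
      using floor_correct[of "1 / (2 * \<sigma>)"] by auto
    with \<open>1 / (2 * \<sigma>) \<ge> 2\<close> have N1: "1 \<le> N" by linarith
    from \<open>real N \<le> 1 / (2 * \<sigma>)\<close> \<open>1 / (2 * \<sigma>) < real N + 1\<close>
    have N\<sigma>: "real N * \<sigma> \<le> 1 / 2" "1 / 2 < (real N + 1) * \<sigma>" using \<sigma> by (auto simp: field_simps)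
    then have N\<sigma>4: "1 / 4 \<le> real N * \<sigma>" using \<sigma>(2) by (simp add: algebra_simps)
    have "exp a \<le> 4 * (real N * \<sigma>) * exp a" using N\<sigma>4 by (simp add: field_simps)
    also have "\<dots> = 4 * real N * (\<sigma> * exp a)" by simp
    finally have NB: "B1 \<le> real N" unfolding \<sigma>e using a(3) by simp
    \<comment> \<open>The centres stay at distance \<open>1/4\<close> from the boundary of the square, the radius is at most \<open>1/16\<close>.\<close>
    define q where "q = (\<lambda>i j::nat. Complex (a + 1 / 4) (2 * pi * real m - 1 / 4) + of_real \<sigma> * Complex (real i) (real j))"
    define P where "P = (\<lambda>(i, j). {z\<in>cball (q i j) (\<sigma> / 4). belyi_exp_exp M z \<in> E \<and> exp (Re (exp (q i j))) \<le> Re (belyi_exp_exp M z)})"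
    have qsub: "cball (q i j) (\<sigma> / 4) \<subseteq> unit_square a m" if ij: "i < N" "j < N" for i j
    proof
      fix z assume z: "z \<in> cball (q i j) (\<sigma> / 4)"
      have b: "0 \<le> \<sigma> * real k" "\<sigma> * real k \<le> 1 / 2" if "k < N" for k
      proof -
        show "0 \<le> \<sigma> * real k" using \<sigma> by simp
        have "real k * \<sigma> \<le> real N * \<sigma>" using that \<sigma> by (intro mult_right_mono) auto
        then show "\<sigma> * real k \<le> 1 / 2" using N\<sigma>(1) by (simp add: mult.commute)
      qed
      have "cmod (z - q i j) \<le> 1 / 16" using z \<sigma> by (simp add: dist_norm norm_minus_commute)
      then have "\<bar>Re (z - q i j)\<bar> \<le> 1 / 16" "\<bar>Im (z - q i j)\<bar> \<le> 1 / 16"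
        using abs_Re_le_cmod[of "z - q i j"] abs_Im_le_cmod[of "z - q i j"] by linarith+
      moreover have "Re (z - q i j) = Re z - a - 1 / 4 - \<sigma> * real i"
        "Im (z - q i j) = Im z - 2 * pi * real m + 1 / 4 - \<sigma> * real j"
        by (simp_all add: q_def)
      ultimately have "a \<le> Re z" "Re z \<le> a + 1" "\<bar>Im z - 2 * pi * real m\<bar> \<le> 1 / 2"
        using b[OF ij(1)] b[OF ij(2)] by linarith+
      then show "z \<in> unit_square a m" by (simp add: in_unit_square_iff)
    qed
    have r_ge: "exp (exp a / 2) \<le> exp (Re (exp (q i j)))" if ij: "i < N" "j < N" for i j
    proof -
      have "q i j \<in> strip_region a"
        using qsub[OF ij] unit_square_subset_strip_region[of a m] \<sigma> by force
      from strip_region_exp[OF this] show ?thesis by simp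
    qed
    have P: "content_ge s (P (i, j)) ((1 / (800 * C)) powr s / 32 * \<sigma> powr s)" if ij: "i < N" "j < N" for i j
    proof -
      define r where "r = exp (Re (exp (q i j)))"
      have r: "R + 20 + 40 * B2 + a \<le> r" unfolding r_def by (rule order_trans[OF a(4) r_ge[OF ij]])
      have r20: "20 \<le> r" using r R(1) B2(1) a(2) by linarith
      have rX: "X \<le> r" using r R(1) B2(1) aX by linarith
      define N2 where "N2 = nat \<lfloor>r / 20\<rfloor>"
      have "r / 20 < real N2 + 1" using r20 by (simp add: N2_def)
      then have "B2 \<le> real N2" using r R(1) a(2) by linarith
      then have "content_ge s {w\<in>E. r \<le> Re w \<and> r \<le> cmod w \<and> cmod w \<le> 4 * r} ((r / 10) powr s / 32)"
        using s r20 rX E by (intro content_ge_large_scale[OF _ _ _ N2_def] B2(2)) auto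
      moreover have "\<exists>z\<in>cball (q i j) (\<sigma> / 4). belyi_exp_exp M z = w" if "r \<le> cmod w" "cmod w \<le> 4 * r" for w
      proof (rule R(2))
        show "R \<le> exp (Re (exp (q i j)))" using r B2(1) a(2) by (simp add: r_def)
        have "q i j \<in> unit_square a m" using qsub[OF ij] \<sigma> by force
        then have "exp a \<le> cmod (exp (q i j))" by (simp add: norm_exp_eq_Re in_unit_square_iff)
        then have "exp a * (\<sigma> / 4) \<le> cmod (exp (q i j)) * (\<sigma> / 4)" using \<sigma> by (intro mult_right_mono) auto
        then show "20 \<le> cmod (exp (q i j)) * (\<sigma> / 4)" using \<sigma>e by (simp add: mult.commute)
      qed (use that \<sigma> in \<open>auto simp: r_def\<close>)
      ultimately have "content_ge s (P (i, j)) ((1 / (10 * lipschitz_const M * exp a)) powr s / 32)"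
        unfolding P_def prod.case r_def
        using qsub[OF ij] unit_square_subset_strip_region[of a m] \<sigma> s a(2)
        by (intro content_ge_small_scale) (auto simp: \<sigma>_def in_unit_square_iff)
      moreover have "1 / (10 * lipschitz_const M * exp a) = 1 / (800 * C) * \<sigma>"
        using C by (simp add: \<sigma>_def C_def exp_minus field_simps)
      moreover have "(1 / (800 * C) * \<sigma>) powr s = (1 / (800 * C)) powr s * \<sigma> powr s"
        using C \<sigma> by (simp add: powr_mult powr_divide)
      ultimately show ?thesis by (simp only: times_divide_eq_left)
    qed
    have "content_ge s (\<Union>i<N. \<Union>j<N. P (i, j)) ((real N * \<sigma>) powr s / 32)"
    proof (rule content_ge_grid[OF s \<sigma>(1) N1, where c = "(1 / (800 * C)) powr s / 32" and p = "Complex (a + 1 / 4) (2 * pi * real m - 1 / 4)"])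
      show "P (i, j) \<subseteq> cball (Complex (a + 1 / 4) (2 * pi * real m - 1 / 4) + of_real \<sigma> * Complex (real i) (real j)) (\<sigma> / 4)" for i j
        by (auto simp: P_def q_def)
    qed (use P B1(2)[OF NB] in auto)
    then show "content_ge s {z\<in>unit_square a m. belyi_exp_exp M z \<in> E \<and> Re z + 1 \<le> Re (belyi_exp_exp M z)} (1 / 512)"
    proof (rule content_ge_mono)
      \<comment> \<open>Since \<open>s < 2\<close>, the constant is \<open>(1/4)^2 / 32 = 1/512\<close>.\<close>
      have "(1 / 4) powr 2 \<le> (1 / 4 :: real) powr s" using s by (intro powr_mono') auto
      also have "\<dots> \<le> (real N * \<sigma>) powr s" using N\<sigma>4 s by (intro powr_mono2) auto
      finally show "1 / 512 \<le> (real N * \<sigma>) powr s / 32" by (simp add: power2_eq_square)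
      show "(\<Union>i<N. \<Union>j<N. P (i, j)) \<subseteq> {z\<in>unit_square a m. belyi_exp_exp M z \<in> E \<and> Re z + 1 \<le> Re (belyi_exp_exp M z)}"
      proof safe
        fix z i j assume ij: "i < N" "j < N" and z: "z \<in> P (i, j)"
        show "z \<in> unit_square a m" using z qsub[OF ij] by (auto simp: P_def)
        then have "Re z \<le> a + 1" by (simp add: in_unit_square_iff)
        moreover have "exp (exp a / 2) \<le> Re (belyi_exp_exp M z)" using z by (intro order_trans[OF r_ge[OF ij]]) (simp add: P_def)
        ultimately show "Re z + 1 \<le> Re (belyi_exp_exp M z)" using a(4) R(1) B2(1) by linarith
        show "belyi_exp_exp M z \<in> E" using z by (simp add: P_def)
      qed
    qed
  qed
qed

text \<open>
  The points whose first \<open>n\<close> iterates stay in the strips and move to the right by at least 1 in each step.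
\<close>
primrec orbit_prefix :: "nat \<Rightarrow> real \<Rightarrow> nat \<Rightarrow> complex set" where
  "orbit_prefix M X 0 = strip_region X"
| "orbit_prefix M X (Suc n) =
     {z\<in>strip_region X. belyi_exp_exp M z \<in> orbit_prefix M X n \<and> Re z + 1 \<le> Re (belyi_exp_exp M z)}"

lemma closed_orbit_prefix:
  assumes "1 \<le> X"
  shows "closed (orbit_prefix M X n)"
proof (induction n)
  have cl: "closed (strip_region X)"
    unfolding strip_region_def by (intro closed_Collect_conj closed_Collect_le continuous_intros)
  {
    case 0
    show ?case using cl by simp
  next
    case (Suc n)
    have cont: "continuous_on (strip_region X) (belyi_exp_exp M)"
    proof (intro continuous_at_imp_continuous_on ballI belyi_exp_exp_isCont notI)
      fix z :: complex assume "z \<in> strip_region X" "exp (exp z) = 1"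
      then show False using strip_region_exp_exp_neq_1[of z X] assms by simp
    qed
    have "closed ((strip_region X \<inter> belyi_exp_exp M -` orbit_prefix M X n) \<inter>
        (strip_region X \<inter> (\<lambda>z. Re (belyi_exp_exp M z) - Re z) -` {1..}))"
      by (intro closed_Int continuous_closed_preimage cl Suc.IH cont continuous_intros closed_atLeast)
    moreover have "orbit_prefix M X (Suc n) = (strip_region X \<inter> belyi_exp_exp M -` orbit_prefix M X n) \<inter>
        (strip_region X \<inter> (\<lambda>z. Re (belyi_exp_exp M z) - Re z) -` {1..})"
      by auto
    ultimately show ?case by simp
  }
qed

lemma orbit_prefix_Suc_subset: "orbit_prefix M X (Suc n) \<subseteq> orbit_prefix M X n"
  by (induction n) auto

lemma orbit_prefix_funpow:
  assumes "z \<in> orbit_prefix M X n" "k \<le> n"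
  shows "(belyi_exp_exp M ^^ k) z \<in> orbit_prefix M X (n - k) \<and> Re z + real k \<le> Re ((belyi_exp_exp M ^^ k) z)"
  using assms(2)
proof (induction k)
  case 0
  then show ?case using assms by simp
next
  case (Suc k)
  then have "n - k = Suc (n - Suc k)" by simp
  then show ?case using Suc by auto
qed

lemma INT_orbit_prefix_subset_escaping_set:
  assumes X: "1 \<le> X"
  shows "(\<Inter>n. orbit_prefix M X n) \<subseteq> escaping_set (belyi_exp_exp M)"
proof
  fix z assume "z \<in> (\<Inter>n. orbit_prefix M X n)"
  then have z: "z \<in> orbit_prefix M X n" for n by blast
  have in_strip: "(belyi_exp_exp M ^^ n) z \<in> strip_region X" for n
    using orbit_prefix_funpow[OF z[of n], of n] by simp
  have grow: "Re z + real n \<le> Re ((belyi_exp_exp M ^^ n) z)" for n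
    using orbit_prefix_funpow[OF z[of n], of n] by simp
  have "\<not> is_pole (belyi_exp_exp M) ((belyi_exp_exp M ^^ n) z)" for n
    by (rule belyi_exp_exp_not_pole[OF strip_region_exp_exp_neq_1[OF in_strip X]])
  moreover have "filterlim (\<lambda>n. (belyi_exp_exp M ^^ n) z) at_infinity sequentially"
    unfolding filterlim_at_infinity_conv_norm_at_top
  proof (rule filterlim_at_top_mono)
    show "filterlim (\<lambda>n. Re z + real n) at_top sequentially"
      by (rule filterlim_tendsto_add_at_top[OF tendsto_const filterlim_real_sequentially])
    show "eventually (\<lambda>n. Re z + real n \<le> cmod ((belyi_exp_exp M ^^ n) z)) sequentially"
      using grow complex_Re_le_cmod order_trans by (intro always_eventually) blast
  qed
  ultimately show "z \<in> escaping_set (belyi_exp_exp M)" by (simp add: escaping_set_def)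
qed

lemma orbit_prefix_content_ge:
  assumes s: "0 < s" "s < 2"
  obtains X where "1 \<le> X" "\<And>a m n. X \<le> a \<Longrightarrow> content_ge s (orbit_prefix M X n \<inter> unit_square a m) (1 / 512)"
proof -
  obtain X where X: "1 \<le> X"
    "\<And>E a m. X \<le> a \<Longrightarrow> (\<And>b m. X \<le> b \<Longrightarrow> content_ge s (E \<inter> unit_square b m) (1 / 512)) \<Longrightarrow>
       content_ge s {z\<in>unit_square a m. belyi_exp_exp M z \<in> E \<and> Re z + 1 \<le> Re (belyi_exp_exp M z)} (1 / 512)"
    using content_ge_unit_square_step[OF s, of M] by blast
  have sub: "unit_square a m \<subseteq> strip_region X" if "X \<le> a" for a m
    using unit_square_subset_strip_region[of a m] that by (auto simp: strip_region_def)
  have "content_ge s (orbit_prefix M X n \<inter> unit_square a m) (1 / 512)" if "X \<le> a" for a m n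
    using that
  proof (induction n arbitrary: a m)
    case 0
    have "orbit_prefix M X 0 \<inter> unit_square a m = unit_square a m" using sub[OF 0] by auto
    then show ?case using content_ge_unit_square[OF s] by (simp add: unit_square_def)
  next
    case (Suc n)
    have "content_ge s {z\<in>unit_square a m. belyi_exp_exp M z \<in> orbit_prefix M X n \<and> Re z + 1 \<le> Re (belyi_exp_exp M z)} (1 / 512)"
      using Suc by (intro X(2)) auto
    then show ?case by (rule content_ge_mono) (use sub[OF Suc.prems] in auto)
  qed
  with X(1) show ?thesis by (rule that)
qed

lemma hausdorff_dim_escaping_set_belyi_exp_exp: "hausdorff_dim (escaping_set (belyi_exp_exp M)) = 2"
proof (rule hausdorff_dim_eq_2I)
  fix s :: real assume s: "0 < s" "s < 2"
  obtain X where X: "1 \<le> X"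
    "\<And>a m n. X \<le> a \<Longrightarrow> content_ge s (orbit_prefix M X n \<inter> unit_square a m) (1 / 512)"
    using orbit_prefix_content_ge[OF s, of M] by blast
  define K where "K = (\<lambda>n. orbit_prefix M X n \<inter> unit_square X 0)"
  show "hausdorff_measure s (escaping_set (belyi_exp_exp M)) \<noteq> 0"
  proof (rule hausdorff_measure_pos_of_content_ge[where K = K and c = "1 / 512"])
    show "compact (K n)" for n
      unfolding K_def unit_square_def
      by (intro closed_Int_compact closed_orbit_prefix X(1) compact_cbox)
    show "K n \<subseteq> K m" if "m \<le> n" for m n
      unfolding K_def using lift_Suc_antimono_le[of "orbit_prefix M X", OF orbit_prefix_Suc_subset that] by blast
    show "content_ge s (K n) (1 / 512)" for n
      unfolding K_def by (rule X(2)) simp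
    show "(\<Inter>n. K n) \<subseteq> escaping_set (belyi_exp_exp M)"
      using INT_orbit_prefix_subset_escaping_set[OF X(1)] unfolding K_def by blast
  qed (use s in auto)
qed

section \<open>Conclusion\<close>

theorem theorem1p2:
  fixes M :: nat
  assumes "M \<ge> 1"
  shows "\<exists>f \<in> speiser_class 3.
           meromorphic_order f = \<infinity> \<and>
           (\<forall>z. is_pole f z \<longrightarrow> pole_multiplicity f z = M) \<and>
           hausdorff_dim (escaping_set f) = 2"
proof (intro bexI conjI allI impI)
  show "belyi_exp_exp M \<in> speiser_class 3" using assms by (rule belyi_exp_exp_in_speiser_class_3)
  show "meromorphic_order (belyi_exp_exp M) = \<infinity>" using assms by (rule meromorphic_order_belyi_exp_exp)
  show "hausdorff_dim (escaping_set (belyi_exp_exp M)) = 2" by (rule hausdorff_dim_escaping_set_belyi_exp_exp)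
  fix z assume "is_pole (belyi_exp_exp M) z"
  then have "exp (exp z) = 1" using assms by (simp add: is_pole_belyi_exp_exp_iff)
  then show "pole_multiplicity (belyi_exp_exp M) z = M" using assms by (simp add: pole_multiplicity_def belyi_exp_exp_pole(2))
qed

end
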